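(* Let $h\in\mathcal{P}_1$. Then $$\frac{\mu_1(h)}{\sigma_1(h)}\le 2,$$ and equality holds if and only if $h=T_{x_0}$ for some $x_0\in[0,1]$. If, in addition, $h(x)=h(1-x)$ for every $x\in[0,1]$, then $$\frac{\mu_1(h)}{\sigma_1(h)}\ge 1.$$
   Context: Let $\mathcal{P}$ be the set of functions $h\in L^\infty(0,1)$ that are non-negative, concave and not identically zero (each such $h$ is identified with its continuous representative on $[0,1]$), and let $\mathcal{P}_1=\{h\in\mathcal{P} : \int_0^1 h(t)\,dt=1\}$. For $h\in\mathcal{P}$ define $$\mu_1(h)=\inf\left\{\frac{\int_0^1 (u')^2 h\,dx}{\int_0^1 u^2 h\,dx} : u\in H^1(0,1),\ u\neq 0,\ \int_0^1 u h\,dx=0\right\},$$ $$\sigma_1(h)=\inf\left\{\frac{\int_0^1 (v')^2 h\,dx}{\int_0^1 v^2\,dx} : v\in H^1(0,1),\ v\neq 0,\ \int_0^1 v\,dx=0\right\}.$$ The triangle functions $T_{x_0}$ on $[0,1]$ are: for $x_0\in(0,1)$, $T_{x_0}(x)=\frac{2x}{x_0}$ for $x\in[0,x_0)$ and $T_{x_0}(x)=\frac{2(1-x)}{1-x_0}$ for $x\in[x_0,1]$; moreover $T_0(x)=2(1-x)$ and $T_1(x)=2x$. *)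

theory Defs
  imports "HOL-Analysis.Analysis"
begin

abbreviation unit_measure :: "real measure" where
  "unit_measure \<equiv> lebesgue_on {0<..<1}"

subsection \<open>The Sobolev space \<open>H\<^sup>1(0,1)\<close>\<close>

definition square_integrable :: "(real \<Rightarrow> real) \<Rightarrow> bool" where
  "square_integrable u \<longleftrightarrow>
     u \<in> borel_measurable unit_measure \<and> integrable unit_measure (\<lambda>x. (u x)\<^sup>2)"

definition test_function :: "(real \<Rightarrow> real) \<Rightarrow> bool" where
  "test_function \<phi> \<longleftrightarrow>
     (\<forall>n x. (deriv ^^ n) \<phi> differentiable (at x)) \<and> closure {x. \<phi> x \<noteq> 0} \<subseteq> {0<..<1}"

definition weak_derivative :: "(real \<Rightarrow> real) \<Rightarrow> (real \<Rightarrow> real) \<Rightarrow> bool" where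
  "weak_derivative u g \<longleftrightarrow>
     (\<forall>\<phi>. test_function \<phi> \<longrightarrow>
        (\<integral>x. u x * deriv \<phi> x \<partial>unit_measure) = - (\<integral>x. g x * \<phi> x \<partial>unit_measure))"

text \<open>
  Elements of \<open>H\<^sup>1(0,1)\<close> are represented by functions on the reals whose values outside
  \<open>(0,1)\<close> are irrelevant. \<open>H1 u u'\<close> says that \<open>u\<close> belongs to \<open>H\<^sup>1(0,1)\<close> and that \<open>u'\<close> is a
  representative of its weak derivative, which is unique up to null sets; the quotients below
  therefore depend on \<open>u\<close> only.
\<close>
definition H1 :: "(real \<Rightarrow> real) \<Rightarrow> (real \<Rightarrow> real) \<Rightarrow> bool" where
  "H1 u u' \<longleftrightarrow> square_integrable u \<and> square_integrable u' \<and> weak_derivative u u'"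

subsection \<open>Weights and eigenvalues\<close>

text \<open>
  Each weight is its continuous representative on \<open>[0,1]\<close>, so that boundedness is automatic.
\<close>
definition weights :: "(real \<Rightarrow> real) set" where
  "weights = {h. continuous_on {0..1} h \<and> concave_on {0..1} h \<and>
                 (\<forall>x\<in>{0..1}. 0 \<le> h x) \<and> (\<exists>x\<in>{0..1}. h x \<noteq> 0)}"

definition weights1 :: "(real \<Rightarrow> real) set" where
  "weights1 = {h \<in> weights. (\<integral>x. h x \<partial>unit_measure) = 1}"

definition mu1 :: "(real \<Rightarrow> real) \<Rightarrow> real" where
  "mu1 h = Inf {(\<integral>x. (u' x)\<^sup>2 * h x \<partial>unit_measure) / (\<integral>x. (u x)\<^sup>2 * h x \<partial>unit_measure) | u u'.
     H1 u u' \<and> \<not> (AE x in unit_measure. u x = 0) \<and> (\<integral>x. u x * h x \<partial>unit_measure) = 0}"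

definition sigma1 :: "(real \<Rightarrow> real) \<Rightarrow> real" where
  "sigma1 h = Inf {(\<integral>x. (v' x)\<^sup>2 * h x \<partial>unit_measure) / (\<integral>x. (v x)\<^sup>2 \<partial>unit_measure) | v v'.
     H1 v v' \<and> \<not> (AE x in unit_measure. v x = 0) \<and> (\<integral>x. v x \<partial>unit_measure) = 0}"

definition triangle_fun :: "real \<Rightarrow> real \<Rightarrow> real" where
  "triangle_fun x\<^sub>0 x =
     (if x\<^sub>0 = 0 then 2 * (1 - x)
      else if x\<^sub>0 = 1 then 2 * x
      else if x < x\<^sub>0 then 2 * x / x\<^sub>0
      else 2 * (1 - x) / (1 - x\<^sub>0))"

end

theory Submission
  imports Defs "HOL-Computational_Algebra.Polynomial"
begin

text \<open>Both eigenvalues are best constants in Poincare inequalities. With \<open>f = u'\<close>, the numerator of either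
  quotient is the energy, the integral of \<open>f\<^sup>2 h\<close>; the denominators are the variances of \<open>u\<close> under the densities
  \<open>h\<close> and \<open>1\<close>. This reduction (\<open>spectral_gap_le\<close>, \<open>le_spectral_gap\<close>) rests on the fact that an element of
  \<open>H\<^sup>1(0,1)\<close> is a primitive of its weak derivative (\<open>H1_representation\<close>).

  Upper bound. Let \<open>H x\<close> be the integral of \<open>h\<close> over \<open>{0..x}\<close>. The substitution \<open>s = H x\<close> turns the density \<open>h\<close> into
  the density \<open>1\<close>, so \<open>v \<mapsto> v \<circ> H\<close> maps the competitors for \<open>sigma1\<close> to competitors for \<open>mu1\<close> with the
  same variance. Its energy is the integral of \<open>v'(s)\<^sup>2 h(x)\<^sup>2\<close> over \<open>s = H x\<close>, and the elementary inequality
  \<open>h(x)\<^sup>2 \<le> 2 h(H x)\<close> (\<open>h_square_le\<close>), a consequence of concavity, bounds it by twice the energy of \<open>v\<close>.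

  Equality. A weight is a triangle if and only if its maximum is \<open>2\<close>. For triangles the elementary
  inequality is an equality and the substitution can be inverted, up to a cut-off at the zeros of \<open>h\<close>
  (\<open>two_sigma_le_mu\<close>). For other weights it is strict on some interval (\<open>h_square_less\<close>). Strictness on an
  interval carries over to the eigenvalues because near-optimal derivatives for \<open>sigma1\<close>, which may be
  taken non-negative (\<open>variance_abs\<close>), cannot be small on an interval (\<open>sigma_stability\<close>); this is proved by a perturbation argument and needs neither
  compactness nor the existence of eigenfunctions.

  Lower bound. For symmetric \<open>h\<close>, any competitor for \<open>mu1\<close> is replaced by an odd monotone function with
  the same energy and no smaller variance under \<open>h\<close>. Its square increases with the distance from
  \<open>1/2\<close> whereas \<open>h\<close> decreases, so by Chebyshev's inequality the variance under the density \<open>1\<close> is larger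
  still (\<open>sigma_le_mu\<close>).\<close>

section \<open>Integration over the unit interval\<close>

interpretation unit: finite_measure unit_measure
  by (intro finite_measure_lebesgue_on) auto

lemma space_unit [simp]: "space unit_measure = {0<..<1}"
  by simp

lemma measure_unit [simp]: "measure unit_measure {0<..<1} = 1"
  by (simp add: measure_restrict_space)

lemma integral_unit_const [simp]: "(\<integral>x. c \<partial>unit_measure) = (c::real)"
  by simp

lemma borel_measurable_unitI:
  "f \<in> borel_measurable borel \<Longrightarrow> f \<in> borel_measurable unit_measure"
  by (intro measurable_restrict_space1 measurable_completion) simp

lemma continuous_measurable_unit:
  fixes g :: "real \<Rightarrow> real"
  assumes "continuous_on {0..1} g"
  shows "g \<in> borel_measurable unit_measure"
  by (rule continuous_imp_measurable_on_sets_lebesgue)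
     (auto intro: continuous_on_subset[OF assms])

lemma integrable_times_bounded:
  fixes f g :: "real \<Rightarrow> real"
  assumes "integrable unit_measure f" "g \<in> borel_measurable unit_measure"
    and "\<And>x. 0 < x \<Longrightarrow> x < 1 \<Longrightarrow> \<bar>g x\<bar> \<le> C"
  shows "integrable unit_measure (\<lambda>x. f x * g x)"
proof (rule Bochner_Integration.integrable_bound)
  show "integrable unit_measure (\<lambda>x. C * f x)"
    using assms(1) by simp
  show "(\<lambda>x. f x * g x) \<in> borel_measurable unit_measure"
    using borel_measurable_integrable[OF assms(1)] assms(2) by simp
  show "AE x in unit_measure. norm (f x * g x) \<le> norm (C * f x)"
  proof (rule AE_I2)
    fix x assume "x \<in> space unit_measure"
    then have "\<bar>g x\<bar> \<le> \<bar>C\<bar>" using assms(3)[of x] by auto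
    then have "\<bar>g x\<bar> * \<bar>f x\<bar> \<le> \<bar>C\<bar> * \<bar>f x\<bar>"
      by (rule mult_right_mono) simp
    then show "norm (f x * g x) \<le> norm (C * f x)"
      by (simp add: abs_mult mult.commute)
  qed
qed

lemma continuous_bounded_unit:
  fixes g :: "real \<Rightarrow> real"
  assumes "continuous_on {0..1} g"
  obtains C where "C > 0" "\<And>x. 0 \<le> x \<Longrightarrow> x \<le> 1 \<Longrightarrow> \<bar>g x\<bar> \<le> C"
proof -
  have "bounded (g ` {0..1})"
    using assms compact_continuous_image compact_imp_bounded by blast
  then obtain C where "C > 0" "\<forall>y \<in> g ` {0..1}. norm y \<le> C"
    by (meson bounded_pos)
  then show ?thesis using that[of C] by auto
qed

lemma integrable_times_continuous:
  fixes f g :: "real \<Rightarrow> real"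
  assumes "integrable unit_measure f" "continuous_on {0..1} g"
  shows "integrable unit_measure (\<lambda>x. f x * g x)"
proof -
  obtain C where "\<And>x. 0 \<le> x \<Longrightarrow> x \<le> 1 \<Longrightarrow> \<bar>g x\<bar> \<le> C"
    using continuous_bounded_unit[OF assms(2)] by metis
  then show ?thesis
    using integrable_times_bounded[OF assms(1) continuous_measurable_unit[OF assms(2)], of C]
    by simp
qed

lemma integrable_continuous_unit:
  fixes g :: "real \<Rightarrow> real"
  assumes "continuous_on {0..1} g"
  shows "integrable unit_measure g"
  using integrable_times_continuous[of "\<lambda>x. 1" g] assms by simp

lemma integral_unit_mono:
  fixes f g :: "real \<Rightarrow> real"
  assumes "integrable unit_measure f" "integrable unit_measure g"
    and "\<And>x. 0 < x \<Longrightarrow> x < 1 \<Longrightarrow> f x \<le> g x"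
  shows "(\<integral>x. f x \<partial>unit_measure) \<le> (\<integral>x. g x \<partial>unit_measure)"
  using assms by (intro integral_mono) auto

lemma integral_unit_nonneg:
  fixes f :: "real \<Rightarrow> real"
  assumes "\<And>x. 0 < x \<Longrightarrow> x < 1 \<Longrightarrow> 0 \<le> f x"
  shows "0 \<le> (\<integral>x. f x \<partial>unit_measure)"
  using assms by (intro Bochner_Integration.integral_nonneg) auto

lemma integral_unit_cong:
  fixes f g :: "real \<Rightarrow> real"
  assumes "\<And>x. 0 < x \<Longrightarrow> x < 1 \<Longrightarrow> f x = g x"
  shows "(\<integral>x. f x \<partial>unit_measure) = (\<integral>x. g x \<partial>unit_measure)"
  using assms by (intro Bochner_Integration.integral_cong) auto

lemma integrable_unit_cong:
  fixes f g :: "real \<Rightarrow> real"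
  assumes "\<And>x. 0 < x \<Longrightarrow> x < 1 \<Longrightarrow> f x = g x"
  shows "integrable unit_measure f \<longleftrightarrow> integrable unit_measure g"
  using assms by (intro Bochner_Integration.integrable_cong) auto

lemma square_integrable_prod:
  assumes "square_integrable f" "square_integrable g"
  shows "integrable unit_measure (\<lambda>x. f x * g x)"
proof (rule Bochner_Integration.integrable_bound)
  show "integrable unit_measure (\<lambda>x. (f x)\<^sup>2 + (g x)\<^sup>2)"
    using assms by (simp add: square_integrable_def)
  show "(\<lambda>x. f x * g x) \<in> borel_measurable unit_measure"
    using assms unfolding square_integrable_def by (intro borel_measurable_times) auto
  have "norm (f x * g x) \<le> norm ((f x)\<^sup>2 + (g x)\<^sup>2)" for x
  proof -
    have "0 \<le> (\<bar>f x\<bar> - \<bar>g x\<bar>)\<^sup>2" "0 \<le> (f x)\<^sup>2" "0 \<le> (g x)\<^sup>2" by auto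
    moreover have "(\<bar>f x\<bar> - \<bar>g x\<bar>)\<^sup>2 = (f x)\<^sup>2 + (g x)\<^sup>2 - 2 * \<bar>f x * g x\<bar>"
      by (simp add: power2_diff abs_mult)
    ultimately have "\<bar>f x * g x\<bar> \<le> (f x)\<^sup>2 + (g x)\<^sup>2"
      by linarith
    then show ?thesis by simp
  qed
  then show "AE x in unit_measure. norm (f x * g x) \<le> norm ((f x)\<^sup>2 + (g x)\<^sup>2)"
    by simp
qed

lemma square_integrable_const: "square_integrable (\<lambda>x. c)"
  by (simp add: square_integrable_def)

lemma square_integrable_integrable:
  assumes "square_integrable f" shows "integrable unit_measure f"
  using square_integrable_prod[OF assms square_integrable_const[of 1]] by simp

lemma square_integrable_measurable:
  assumes "square_integrable f" shows "f \<in> borel_measurable unit_measure"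
  using assms by (simp add: square_integrable_def)

lemma square_integrable_square:
  assumes "square_integrable f" shows "integrable unit_measure (\<lambda>x. (f x)\<^sup>2)"
  using assms by (simp add: square_integrable_def)

lemma square_integrable_times_bounded:
  assumes "square_integrable f" "g \<in> borel_measurable unit_measure"
    and "\<And>x. 0 < x \<Longrightarrow> x < 1 \<Longrightarrow> \<bar>g x\<bar> \<le> C"
  shows "square_integrable (\<lambda>x. f x * g x)"
proof -
  have "integrable unit_measure (\<lambda>x. (f x)\<^sup>2 * (g x)\<^sup>2)"
  proof (rule integrable_times_bounded[where C = "C\<^sup>2"])
    fix x :: real assume "0 < x" "x < 1"
    then show "\<bar>(g x)\<^sup>2\<bar> \<le> C\<^sup>2"
      using assms(3)[of x] by (simp add: abs_le_square_iff[symmetric])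
  qed (use assms in \<open>auto simp: square_integrable_def\<close>)
  moreover have "(\<lambda>x. f x * g x) \<in> borel_measurable unit_measure"
    using assms unfolding square_integrable_def by (intro borel_measurable_times) auto
  ultimately show ?thesis by (simp add: square_integrable_def power_mult_distrib)
qed

lemma square_integrable_cmult:
  assumes "square_integrable f" shows "square_integrable (\<lambda>x. c * f x)"
  using square_integrable_times_bounded[OF assms, of "\<lambda>x. c" "\<bar>c\<bar>"] by (simp add: mult.commute)

lemma square_integrable_add:
  assumes "square_integrable f" "square_integrable g"
  shows "square_integrable (\<lambda>x. f x + g x)"
  using assms square_integrable_prod[OF assms]
  by (auto simp: square_integrable_def power2_sum mult.assoc)

lemma square_integrable_abs:
  assumes "square_integrable f" shows "square_integrable (\<lambda>x. \<bar>f x\<bar>)"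
  using assms unfolding square_integrable_def by (auto intro: borel_measurable_abs)

lemma square_integrable_continuous:
  assumes "continuous_on {0..1} g" shows "square_integrable g"
  using assms unfolding square_integrable_def
  by (auto intro!: continuous_measurable_unit integrable_continuous_unit continuous_intros)

lemma AE_unitI:
  assumes "AE x in lebesgue. P x" shows "AE x in unit_measure. P x"
proof -
  have "AE x in lebesgue. x \<in> {0<..<1} \<longrightarrow> P x" using assms by eventually_elim simp
  then show ?thesis by (subst AE_restrict_space_iff) auto
qed

lemma AE_unit_neq: "AE x in unit_measure. x \<noteq> (t::real)"
  by (rule AE_unitI, rule AE_I'[of "{t}"]) auto

section \<open>Primitives\<close>

definition prim :: "(real \<Rightarrow> real) \<Rightarrow> real \<Rightarrow> real" where
  "prim f x = (\<integral>t. f t * indicator {..x} t \<partial>unit_measure)"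

lemma integrable_indicator_unit:
  fixes f :: "real \<Rightarrow> real"
  assumes "integrable unit_measure f" "A \<in> sets borel"
  shows "integrable unit_measure (\<lambda>t. f t * indicator A t)"
  by (rule integrable_times_bounded[OF assms(1), where C = 1])
     (use assms in \<open>auto intro!: borel_measurable_unitI borel_measurable_indicator simp: indicator_def\<close>)

lemma prim_0: "prim f 0 = 0"
  unfolding prim_def by (subst integral_unit_cong[where g = "\<lambda>x. 0"]) (auto simp: indicator_def)

lemma prim_1: "prim f 1 = (\<integral>t. f t \<partial>unit_measure)"
  unfolding prim_def by (rule integral_unit_cong) (auto simp: indicator_def)

lemma prim_add:
  assumes "integrable unit_measure f" "integrable unit_measure g"
  shows "prim (\<lambda>x. f x + g x) y = prim f y + prim g y"
  unfolding prim_def distrib_right using assms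
  by (intro Bochner_Integration.integral_add integrable_indicator_unit) auto

lemma prim_cmult: "prim (\<lambda>x. c * f x) y = c * prim f y"
  unfolding prim_def mult.assoc by simp

lemma prim_cong:
  assumes "\<And>x. 0 < x \<Longrightarrow> x < 1 \<Longrightarrow> f x = g x"
  shows "prim f y = prim g y"
  unfolding prim_def using assms by (intro integral_unit_cong) auto

lemma prim_diff:
  fixes f :: "real \<Rightarrow> real"
  assumes "integrable unit_measure f" "x \<le> y"
  shows "prim f y - prim f x = (\<integral>t. f t * indicator {x<..y} t \<partial>unit_measure)"
proof -
  have "prim f y - prim f x = (\<integral>t. f t * indicator {..y} t - f t * indicator {..x} t \<partial>unit_measure)"
    unfolding prim_def using assms
    by (intro Bochner_Integration.integral_diff[symmetric] integrable_indicator_unit) auto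
  also have "\<dots> = (\<integral>t. f t * indicator {x<..y} t \<partial>unit_measure)"
    using assms(2) by (intro integral_unit_cong) (auto simp: indicator_def)
  finally show ?thesis .
qed

lemma prim_mono:
  fixes f :: "real \<Rightarrow> real"
  assumes "integrable unit_measure f" "x \<le> y" "\<And>t. 0 < t \<Longrightarrow> t < 1 \<Longrightarrow> 0 \<le> f t"
  shows "prim f x \<le> prim f y"
proof -
  have "0 \<le> prim f y - prim f x"
    unfolding prim_diff[OF assms(1,2)] by (rule integral_unit_nonneg) (use assms(3) in auto)
  then show ?thesis by simp
qed

lemma prim_eq_integral:
  fixes f :: "real \<Rightarrow> real"
  assumes "integrable unit_measure f" "0 \<le> x" "x \<le> 1"
  shows "prim f x = integral {0..x} f"
proof -
  have "prim f x = integral {0<..<1} (\<lambda>t. f t * indicator {..x} t)"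
    unfolding prim_def
    by (rule lebesgue_integral_eq_integral) (use integrable_indicator_unit[OF assms(1)] in auto)
  also have "\<dots> = integral {0<..<1} (\<lambda>t. if t \<in> {0..x} then f t else 0)"
    by (rule Henstock_Kurzweil_Integration.integral_cong) (auto simp: indicator_def)
  also have "\<dots> = integral ({0..x} \<inter> {0<..<1}) f"
    by (simp only: integral_restrict_Int)
  also have "\<dots> = integral {0..x} f"
  proof (rule integral_subset_negligible)
    have "{0..x} - {0..x} \<inter> {0<..<1} \<subseteq> {0,1}" using assms by auto
    then show "negligible ({0..x} - {0..x} \<inter> {0<..<1})"
      by (rule negligible_subset[rotated]) simp
  qed auto
  finally show ?thesis .
qed

lemma integrable_on_unit:
  fixes f :: "real \<Rightarrow> real"
  assumes "integrable unit_measure f" shows "f integrable_on {0..1}"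
proof -
  have "f integrable_on {0<..<1}"
    using assms by (intro integrable_on_lebesgue_on) auto
  then show ?thesis
    using integrable_on_open_interval_real by blast
qed

lemma continuous_prim:
  fixes f :: "real \<Rightarrow> real"
  assumes "integrable unit_measure f" shows "continuous_on {0..1} (prim f)"
proof -
  have "continuous_on {0..1} (\<lambda>x. integral {0..x} f)"
    using integrable_on_unit[OF assms] by (rule indefinite_integral_continuous_1)
  then show ?thesis
    by (rule continuous_on_eq) (simp add: prim_eq_integral[OF assms])
qed

lemma prim_has_derivative:
  fixes f :: "real \<Rightarrow> real"
  assumes "continuous_on {0..1} f" "0 < x" "x < 1"
  shows "(prim f has_real_derivative f x) (at x)"
proof -
  have "((\<lambda>x. integral {0..x} f) has_real_derivative f x) (at x within {0..1})"
    using assms by (intro integral_has_real_derivative) auto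
  then have "((\<lambda>x. integral {0..x} f) has_real_derivative f x) (at x)"
    using assms by (simp add: at_within_Icc_at)
  then show ?thesis
    by (rule has_field_derivative_transform_within_open[where S = "{0<..<1}"])
       (use assms in \<open>auto simp: prim_eq_integral integrable_continuous_unit\<close>)
qed

lemma prim_FTC:
  fixes F f :: "real \<Rightarrow> real"
  assumes "continuous_on {0..1} f" "0 \<le> x" "x \<le> 1"
    and "\<And>t. 0 \<le> t \<Longrightarrow> t \<le> 1 \<Longrightarrow> (F has_real_derivative f t) (at t)"
  shows "prim f x = F x - F 0"
proof -
  have "(f has_integral F x - F 0) {0..x}"
    using assms by (intro fundamental_theorem_of_calculus)
      (auto simp: has_real_derivative_iff_has_vector_derivative[symmetric]
            intro: has_field_derivative_at_within)
  then show ?thesis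
    using assms by (simp add: prim_eq_integral integrable_continuous_unit integral_unique)
qed

lemma prim_const:
  assumes "0 \<le> x" "x \<le> 1" shows "prim (\<lambda>x. c) x = c * x"
  using prim_FTC[of "\<lambda>x. c" x "\<lambda>x. c * x"] assms by (auto intro!: derivative_eq_intros)

text \<open>Integration by parts for absolutely continuous functions, obtained by exchanging the order of
  integration over the triangle \<open>t \<le> x\<close>. Fubini's theorem gives it under mere integrability of
  both factors, which is what elements of \<open>H\<^sup>1\<close> provide.\<close>
lemma prim_by_parts:
  fixes f g :: "real \<Rightarrow> real"
  assumes f: "integrable unit_measure f" and g: "integrable unit_measure g"
  shows "(\<integral>x. g x * prim f x \<partial>unit_measure) =
         (\<integral>t. f t * ((\<integral>x. g x \<partial>unit_measure) - prim g t) \<partial>unit_measure)"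
proof -
  interpret P: pair_sigma_finite unit_measure unit_measure
    by (rule pair_sigma_finite.intro) (auto intro: unit.sigma_finite_measure_axioms)
  let ?K = "\<lambda>x t. g x * (f t * indicator {..x} t)"
  have [measurable]: "f \<in> borel_measurable unit_measure" "g \<in> borel_measurable unit_measure"
    using f g by (simp_all add: borel_measurable_integrable)
  have idm [measurable]: "(\<lambda>x. x) \<in> measurable unit_measure borel"
    by (rule borel_measurable_unitI) simp
  have "{p \<in> space (unit_measure \<Otimes>\<^sub>M unit_measure). snd p \<le> fst p}
      \<in> sets (unit_measure \<Otimes>\<^sub>M unit_measure)"
  proof (rule borel_measurable_le)
    show "snd \<in> borel_measurable (unit_measure \<Otimes>\<^sub>M unit_measure)"
      using measurable_compose[OF measurable_snd idm] by simp
    show "fst \<in> borel_measurable (unit_measure \<Otimes>\<^sub>M unit_measure)"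
      using measurable_compose[OF measurable_fst idm] by simp
  qed
  then have ind: "(\<lambda>p. indicator {p. snd p \<le> fst p} p :: real)
      \<in> borel_measurable (unit_measure \<Otimes>\<^sub>M unit_measure)"
    by (simp add: borel_measurable_indicator_iff Int_def conj_commute)
  have "(\<lambda>p. g (fst p) * (f (snd p) * indicator {p. snd p \<le> fst p} p))
      \<in> borel_measurable (unit_measure \<Otimes>\<^sub>M unit_measure)"
    using ind by measurable
  then have meas: "case_prod ?K \<in> borel_measurable (unit_measure \<Otimes>\<^sub>M unit_measure)"
    by (simp add: case_prod_beta' indicator_def)
  have int: "integrable (unit_measure \<Otimes>\<^sub>M unit_measure) (case_prod ?K)"
  proof (rule P.Fubini_integrable[OF meas])
    have "integrable unit_measure (\<lambda>x. \<bar>g x\<bar> * prim (\<lambda>t. \<bar>f t\<bar>) x)"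
      using f g by (intro integrable_times_continuous continuous_prim) auto
    moreover have "(\<integral>t. norm (?K x t) \<partial>unit_measure) = \<bar>g x\<bar> * prim (\<lambda>t. \<bar>f t\<bar>) x" for x
      by (simp add: prim_def abs_mult)
    ultimately show "integrable unit_measure (\<lambda>x. \<integral>t. norm (case_prod ?K (x, t)) \<partial>unit_measure)"
      by simp
    show "AE x in unit_measure. integrable unit_measure (\<lambda>t. case_prod ?K (x, t))"
      using integrable_indicator_unit[OF f] by simp
  qed
  have inner: "(\<integral>x. ?K x t \<partial>unit_measure) = f t * ((\<integral>x. g x \<partial>unit_measure) - prim g t)" for t
  proof -
    have "(\<integral>x. g x \<partial>unit_measure) - prim g t = (\<integral>x. g x - g x * indicator {..t} x \<partial>unit_measure)"
      unfolding prim_def using g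
      by (intro Bochner_Integration.integral_diff[symmetric] integrable_indicator_unit) auto
    also have "\<dots> = (\<integral>x. g x * indicator {..x} t \<partial>unit_measure)"
    proof (rule integral_cong_AE)
      show "AE x in unit_measure. g x - g x * indicator {..t} x = g x * indicator {..x} t"
        using AE_unit_neq[of t] by eventually_elim (auto simp: indicator_def)
      have "(\<lambda>x. g x * indicator {t..} x) \<in> borel_measurable unit_measure"
        by measurable
      then show "(\<lambda>x. g x * indicator {..x} t) \<in> borel_measurable unit_measure"
        by (simp add: indicator_def)
    qed measurable
    finally have "f t * ((\<integral>x. g x \<partial>unit_measure) - prim g t)
        = (\<integral>x. f t * (g x * indicator {..x} t) \<partial>unit_measure)"
      by simp
    then show ?thesis by (simp only: mult.left_commute)
  qed
  have "(\<integral>x. g x * prim f x \<partial>unit_measure) = (\<integral>x. (\<integral>t. ?K x t \<partial>unit_measure) \<partial>unit_measure)"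
    by (simp add: prim_def)
  also have "\<dots> = (\<integral>t. (\<integral>x. ?K x t \<partial>unit_measure) \<partial>unit_measure)"
    using P.Fubini_integral[OF int] by simp
  also have "\<dots> = (\<integral>t. f t * ((\<integral>x. g x \<partial>unit_measure) - prim g t) \<partial>unit_measure)"
    by (simp only: inner)
  finally show ?thesis .
qed

section \<open>Weakly differentiable functions are primitives\<close>

text \<open>The function \<open>p(1/t) exp(-1/t)\<close>, continued by \<open>0\<close> to \<open>t \<le> 0\<close>. The polynomial factor makes the family
  stable under differentiation, so that smoothness needs first derivatives only.\<close>
definition flat :: "real poly \<Rightarrow> real \<Rightarrow> real" where
  "flat p t = (if t > 0 then poly p (1/t) * exp (- (1/t)) else 0)"

lemma poly_exp_tendsto_0: "((\<lambda>s::real. poly p s * exp (- s)) \<longlongrightarrow> 0) at_top"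
proof -
  have "((\<lambda>s::real. \<Sum>i\<le>degree p. coeff p i * (s ^ i / exp s)) \<longlongrightarrow> (\<Sum>i\<le>degree p. coeff p i * 0)) at_top"
    by (intro tendsto_sum tendsto_mult tendsto_const tendsto_power_div_exp_0)
  moreover have "poly p s * exp (- s) = (\<Sum>i\<le>degree p. coeff p i * (s ^ i / exp s))" for s :: real
    by (simp add: poly_altdef exp_minus divide_inverse sum_distrib_right mult.assoc)
  ultimately show ?thesis by simp
qed

text \<open>For \<open>t > 0\<close> and \<open>s = 1/t\<close> the derivative of \<open>p(s) exp(-s)\<close> is \<open>s\<^sup>2 (p(s) - p'(s)) exp(-s)\<close>, again of the
  same form. At \<open>0\<close> the difference quotient is \<open>s p(s) exp(-s)\<close>, which vanishes as \<open>s\<close> tends to infinity.\<close>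
lemma flat_has_derivative:
  "(flat p has_real_derivative flat ([:0, 0, 1:] * (p - pderiv p)) t) (at t)"
proof -
  consider "t > 0" | "t < 0" | "t = 0" by linarith
  then show ?thesis
  proof cases
    case 1
    have "((\<lambda>t. poly p (1/t) * exp (- (1/t))) has_real_derivative
        flat ([:0, 0, 1:] * (p - pderiv p)) t) (at t)"
      using 1 by (auto intro!: derivative_eq_intros poly_DERIV[THEN DERIV_chain2]
           simp: flat_def field_simps power2_eq_square)
    then show ?thesis
      by (rule has_field_derivative_transform_within_open[where S = "{0<..}"])
         (use 1 in \<open>auto simp: flat_def\<close>)
  next
    case 2
    have "((\<lambda>t. 0) has_real_derivative flat ([:0, 0, 1:] * (p - pderiv p)) t) (at t)"
      using 2 by (simp add: flat_def)
    then show ?thesis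
      by (rule has_field_derivative_transform_within_open[where S = "{..<0}"])
         (use 2 in \<open>auto simp: flat_def\<close>)
  next
    case 3
    have "((\<lambda>h. flat p h / h) \<longlongrightarrow> 0) (at 0)"
    proof (rule filterlim_split_at)
      have "\<forall>\<^sub>F h in at_left (0::real). flat p h / h = 0"
        unfolding eventually_at_filter by (rule always_eventually) (auto simp: flat_def)
      then show "((\<lambda>h. flat p h / h) \<longlongrightarrow> 0) (at_left 0)"
        by (simp add: tendsto_eventually)
      have "((\<lambda>h::real. poly ([:0,1:] * p) (inverse h) * exp (- inverse h)) \<longlongrightarrow> 0) (at_right 0)"
        using filterlim_compose[OF poly_exp_tendsto_0 filterlim_inverse_at_top_right] .
      moreover have "\<forall>\<^sub>F h in at_right (0::real).
          poly ([:0,1:] * p) (inverse h) * exp (- inverse h) = flat p h / h"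
      proof (rule eventually_mono[OF eventually_at_right_less])
        fix h :: real assume "0 < h"
        then show "poly ([:0,1:] * p) (inverse h) * exp (- inverse h) = flat p h / h"
          by (simp only: flat_def poly_mult) (simp add: divide_inverse mult.commute)
      qed
      ultimately show "((\<lambda>h. flat p h / h) \<longlongrightarrow> 0) (at_right 0)"
        by (rule Lim_transform_eventually)
    qed
    then show ?thesis using 3 by (simp add: DERIV_def flat_def)
  qed
qed

text \<open>An explicit algebra of functions that contains the derivatives of its members; all of
  them are therefore smooth.\<close>
inductive bump_algebra :: "(real \<Rightarrow> real) \<Rightarrow> bool" where
  flat: "bump_algebra (\<lambda>x. flat p (c * x + d))"
| mult: "bump_algebra f \<Longrightarrow> bump_algebra g \<Longrightarrow> bump_algebra (\<lambda>x. f x * g x)"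
| add: "bump_algebra f \<Longrightarrow> bump_algebra g \<Longrightarrow> bump_algebra (\<lambda>x. f x + g x)"

lemma flat_smult: "flat (smult c p) t = c * flat p t"
  by (simp add: flat_def)

lemma bump_algebra_cmult:
  assumes "bump_algebra f" shows "bump_algebra (\<lambda>x. c * f x)"
  using assms
proof induction
  case (flat p c' d)
  show ?case using bump_algebra.flat[of "smult c p" c' d] by (simp add: flat_smult)
next
  case (mult f g)
  then show ?case using bump_algebra.mult[OF mult.IH(1) mult.hyps(2)] by (simp add: mult.assoc)
next
  case (add f g)
  then show ?case using bump_algebra.add[OF add.IH] by (simp add: distrib_left)
qed

lemma bump_algebra_derivative:
  assumes "bump_algebra f"
  shows "\<exists>f'. bump_algebra f' \<and> (\<forall>x. (f has_real_derivative f' x) (at x))"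
  using assms
proof induction
  case (flat p c d)
  let ?q = "[:0, 0, 1:] * (p - pderiv p)"
  have "((\<lambda>x. flat p (c * x + d)) has_real_derivative flat (smult c ?q) (c * x + d)) (at x)" for x
  proof -
    have "((\<lambda>x. c * x + d) has_real_derivative c) (at x)"
      by (auto intro!: derivative_eq_intros)
    from DERIV_chain2[OF flat_has_derivative this] show ?thesis
      unfolding flat_smult by (simp only: mult.commute)
  qed
  then show ?case using bump_algebra.flat by blast
next
  case (mult f g)
  then obtain f' g' where "bump_algebra f'" "bump_algebra g'"
    "\<And>x. (f has_real_derivative f' x) (at x)" "\<And>x. (g has_real_derivative g' x) (at x)" by blast
  with mult show ?case
    by (intro exI[of _ "\<lambda>x. f' x * g x + f x * g' x"])
       (auto intro!: bump_algebra.intros derivative_eq_intros)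
next
  case (add f g)
  then obtain f' g' where "bump_algebra f'" "bump_algebra g'"
    "\<And>x. (f has_real_derivative f' x) (at x)" "\<And>x. (g has_real_derivative g' x) (at x)" by blast
  then show ?case
    by (intro exI[of _ "\<lambda>x. f' x + g' x"]) (auto intro!: bump_algebra.intros derivative_eq_intros)
qed

lemma bump_algebra_iterated_deriv:
  assumes "bump_algebra f" shows "bump_algebra ((deriv ^^ n) f)"
proof (induction n)
  case (Suc n)
  then obtain f' where f': "bump_algebra f'" "\<And>x. ((deriv ^^ n) f has_real_derivative f' x) (at x)"
    using bump_algebra_derivative by blast
  then have "deriv ((deriv ^^ n) f) = f'"
    by (intro ext DERIV_imp_deriv)
  then show ?case using f' by simp
qed (use assms in simp)

lemma bump_algebra_differentiable:
  assumes "bump_algebra f" shows "f differentiable (at x)"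
  using bump_algebra_derivative[OF assms] real_differentiable_def by blast

lemma bump_algebra_continuous:
  assumes "bump_algebra f" shows "continuous_on S f"
  using bump_algebra_differentiable[OF assms]
  by (meson continuous_at_imp_continuous_on differentiable_imp_continuous_within)

text \<open>The vanishing mean lets the primitive return to zero at the right end of the support.\<close>
lemma test_function_primitive:
  assumes \<psi>: "bump_algebra \<psi>" and ab: "0 < a" "a \<le> b" "b < 1"
    and supp: "\<And>x. x \<notin> {a..b} \<Longrightarrow> \<psi> x = 0" and mean: "(\<integral>x. \<psi> x \<partial>unit_measure) = 0"
  shows "\<exists>\<phi>. test_function \<phi> \<and> deriv \<phi> = \<psi>"
proof -
  have "\<exists>F. \<forall>x::real. - \<infinity> < ereal x \<longrightarrow> ereal x < \<infinity> \<longrightarrow> (F has_vector_derivative \<psi> x) (at x)"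
    by (rule einterval_antiderivative)
       (use bump_algebra_differentiable[OF \<psi>] in \<open>auto intro: differentiable_imp_continuous_within\<close>)
  then obtain F where F: "\<And>x. (F has_real_derivative \<psi> x) (at x)"
    by (auto simp: has_real_derivative_iff_has_vector_derivative)
  define \<phi> where "\<phi> x = F x - F 0" for x
  have d: "(\<phi> has_real_derivative \<psi> x) (at x)" for x
    unfolding \<phi>_def using F[of x] by (auto intro!: derivative_eq_intros)
  then have deriv: "deriv \<phi> = \<psi>" by (intro ext DERIV_imp_deriv)
  have "prim \<psi> 1 = F 1 - F 0"
    by (rule prim_FTC) (use F bump_algebra_continuous[OF \<psi>] in auto)
  then have F01: "F 1 = F 0" using mean by (simp add: prim_1)
  have left: "F x = F 0" if "x < a" for x
  proof (rule has_field_derivative_zero_constant[of "{..<a}" F, THEN exE])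
    show "(F has_field_derivative 0) (at y within {..<a})" if "y \<in> {..<a}" for y
      using F[of y] supp[of y] that by (auto intro: has_field_derivative_at_within)
    fix c assume "\<forall>y\<in>{..<a}. F y = c"
    then show ?thesis using that ab by simp
  qed simp
  have right: "F x = F 1" if "x > b" for x
  proof (rule has_field_derivative_zero_constant[of "{b<..}" F, THEN exE])
    show "(F has_field_derivative 0) (at y within {b<..})" if "y \<in> {b<..}" for y
      using F[of y] supp[of y] that by (auto intro: has_field_derivative_at_within)
    fix c assume "\<forall>y\<in>{b<..}. F y = c"
    then show ?thesis using that ab by simp
  qed simp
  have "{x. \<phi> x \<noteq> 0} \<subseteq> {a..b}"
    using left right F01 unfolding \<phi>_def by (auto simp: not_less[symmetric])
  then have "closure {x. \<phi> x \<noteq> 0} \<subseteq> {a..b}"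
    by (rule closure_minimal) simp
  then have "closure {x. \<phi> x \<noteq> 0} \<subseteq> {0<..<1}" using ab by auto
  moreover have "(deriv ^^ n) \<phi> differentiable (at x)" for n x
  proof (cases n)
    case 0
    then show ?thesis using d real_differentiable_def by auto
  next
    case (Suc m)
    then have "(deriv ^^ n) \<phi> = (deriv ^^ m) \<psi>" by (simp only: funpow_Suc_right o_apply deriv)
    then show ?thesis using bump_algebra_differentiable bump_algebra_iterated_deriv[OF \<psi>] by metis
  qed
  ultimately show ?thesis using deriv unfolding test_function_def by blast
qed

text \<open>Smooth functions supported in \<open>{a..b}\<close> that tend to the indicator function of \<open>{a<..<b}\<close> as \<open>n\<close> grows.\<close>
definition bump :: "real \<Rightarrow> real \<Rightarrow> nat \<Rightarrow> real \<Rightarrow> real" where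
  "bump a b n x = flat 1 (real n * x + - (real n * a)) * flat 1 (- real n * x + real n * b)"

lemma bump_algebra_bump: "bump_algebra (bump a b n)"
  unfolding bump_def[abs_def] by (intro bump_algebra.intros)

lemma flat_1_bounds: "0 \<le> flat 1 t" "flat 1 t \<le> 1"
  by (auto simp: flat_def)

lemma bump_bounds: "0 \<le> bump a b n x" "bump a b n x \<le> 1"
  unfolding bump_def using flat_1_bounds by (auto intro: mult_le_one)

lemma bump_support:
  assumes "x \<notin> {a..b}" shows "bump a b n x = 0"
proof -
  have "real n * x + - (real n * a) \<le> 0 \<or> - real n * x + real n * b \<le> 0"
    using assms by (auto simp: not_le mult_left_mono)
  then show ?thesis by (auto simp: bump_def flat_def)
qed

lemma flat_1_tendsto:
  assumes "t > 0" shows "(\<lambda>n. flat 1 (real n * t)) \<longlonglongrightarrow> 1"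
proof -
  have "(\<lambda>n. exp (- (1/t * inverse (real n)))) \<longlonglongrightarrow> exp (- (1/t * 0))"
    by (intro tendsto_intros lim_inverse_n)
  moreover have "\<forall>\<^sub>F n in sequentially. exp (- (1/t * inverse (real n))) = flat 1 (real n * t)"
    using eventually_gt_at_top[of "0::nat"]
    by eventually_elim (use assms in \<open>simp add: flat_def field_simps\<close>)
  ultimately show ?thesis using Lim_transform_eventually by fastforce
qed

lemma bump_tendsto:
  assumes "a < b"
  shows "(\<lambda>n. bump a b n x) \<longlonglongrightarrow> indicator {a<..<b} x"
proof (cases "x \<in> {a<..<b}")
  case True
  have "(\<lambda>n. flat 1 (real n * (x - a)) * flat 1 (real n * (b - x))) \<longlonglongrightarrow> 1 * 1"
    using True by (intro tendsto_mult flat_1_tendsto) auto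
  then show ?thesis using True by (simp add: bump_def algebra_simps)
next
  case False
  have "bump a b n x = 0" for n
    using bump_support[of x a b n] False assms
    by (cases "x \<in> {a..b}") (auto simp: bump_def flat_def not_less order.antisym)
  then show ?thesis using False by simp
qed

text \<open>By Lebesgue's differentiation theorem \<open>z\<close> is almost everywhere the limit of its averages over
  \<open>{x..x+h}\<close>, and these are all zero.\<close>
lemma AE_zero_of_prim_constant:
  fixes z :: "real \<Rightarrow> real"
  assumes z: "integrable unit_measure z"
    and z_const: "\<And>a b. 0 < a \<Longrightarrow> a < b \<Longrightarrow> b < 1 \<Longrightarrow> prim z a = prim z b"
  shows "AE x in unit_measure. z x = 0"
proof -
  define f where "f x = (if x \<in> {0..1} then z x else 0)" for x
  have "f integrable_on UNIV"
    unfolding f_def by (simp only: integrable_restrict_UNIV integrable_on_unit[OF z])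
  then have "f integrable_on cbox a b" for a b
    by (rule integrable_on_subcbox) simp
  from integrable_ccontinuous_explicit[of f, OF this] obtain N where N: "negligible N"
    "\<And>x e. x \<notin> N \<Longrightarrow> 0 < e \<Longrightarrow> \<exists>d>0. \<forall>h. 0 < h \<and> h < d \<longrightarrow>
        norm (integral (cbox x (x + h *\<^sub>R One)) f /\<^sub>R h ^ DIM(real) - f x) < e"
    by metis
  have zero: "z x = 0" if x: "x \<notin> N" "0 < x" "x < 1" for x
  proof (rule ccontr)
    assume "z x \<noteq> 0"
    then obtain d where d: "d > 0" "\<And>h. 0 < h \<Longrightarrow> h < d \<Longrightarrow>
        norm (integral (cbox x (x + h *\<^sub>R One)) f /\<^sub>R h ^ DIM(real) - f x) < \<bar>z x\<bar>"
      using N(2)[OF x(1), of "\<bar>z x\<bar>"] by auto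
    define h where "h = min d (1 - x) / 2"
    have h: "0 < h" "h < d" "x + h < 1" using d(1) x by (auto simp: h_def field_simps)
    have "integral {x..x+h} f = integral {x..x+h} z"
      using h x by (intro Henstock_Kurzweil_Integration.integral_cong) (auto simp: f_def)
    also have "\<dots> = integral {0..x+h} z - integral {0..x} z"
    proof -
      have "z integrable_on {0..x+h}"
        using integrable_on_unit[OF z] by (rule integrable_on_subinterval) (use h x in auto)
      then have "integral {0..x} z + integral {x..x+h} z = integral {0..x+h} z"
        by (intro Henstock_Kurzweil_Integration.integral_combine) (use h x in auto)
      then show ?thesis by simp
    qed
    also have "\<dots> = prim z (x + h) - prim z x"
      using h x by (simp add: prim_eq_integral[OF z])
    also have "\<dots> = 0" using z_const[of x "x + h"] h x by simp
    finally show False using d(2)[of h] h x by (simp add: f_def cbox_interval)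
  qed
  have "AE x in lebesgue. x \<notin> N"
    using N(1) by (intro AE_not_in) (simp add: negligible_iff_null_sets)
  then have "AE x in unit_measure. x \<notin> N"
    by (rule AE_unitI)
  moreover have "AE x in unit_measure. 0 < x \<and> x < 1"
    by (rule AE_I2) auto
  ultimately show ?thesis by eventually_elim (use zero in auto)
qed

text \<open>Let \<open>c\<close> be the mean of \<open>w\<close> against a fixed bump \<open>\<rho>\<close>. Any other bump becomes the derivative of a test
  function once the multiple of \<open>\<rho>\<close> with the same integral is subtracted, so \<open>w - c\<close> is orthogonal to all
  bumps, hence to all indicator functions of intervals.\<close>
lemma du_Bois_Reymond:
  fixes w :: "real \<Rightarrow> real"
  assumes w: "integrable unit_measure w"
    and orth: "\<And>\<phi>. test_function \<phi> \<Longrightarrow> (\<integral>x. w x * deriv \<phi> x \<partial>unit_measure) = 0"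
  shows "\<exists>c. AE x in unit_measure. w x = c"
proof -
  define \<rho> where "\<rho> = bump (1/4) (3/4) 1"
  have \<rho>: "bump_algebra \<rho>" unfolding \<rho>_def by (rule bump_algebra_bump)
  have int: "integrable unit_measure f" if "bump_algebra f" for f
    using bump_algebra_continuous[OF that] by (rule integrable_continuous_unit)
  have wint: "integrable unit_measure (\<lambda>x. w x * f x)" if "bump_algebra f" for f
    using w bump_algebra_continuous[OF that] by (rule integrable_times_continuous)
  define r where "r = (\<integral>x. \<rho> x \<partial>unit_measure)"
  have "r > 0"
  proof -
    have pos: "\<rho> x > 0" if "1/4 < x" "x < 3/4" for x
      using that by (auto simp: \<rho>_def bump_def flat_def)
    have "r \<ge> 0" unfolding r_def \<rho>_def by (rule integral_unit_nonneg) (rule bump_bounds)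
    moreover have "r \<noteq> 0"
    proof
      assume "r = 0"
      then have "AE x in unit_measure. \<rho> x = 0"
        using integral_nonneg_eq_0_iff_AE[OF int[OF \<rho>]] bump_bounds unfolding r_def \<rho>_def by simp
      then have "AE x in lebesgue. x \<in> {0<..<1} \<longrightarrow> \<rho> x = 0"
        by (subst (asm) AE_restrict_space_iff) auto
      then have "AE x in lebesgue. x \<notin> {1/4<..<3/4::real}"
        by eventually_elim (use pos in force)
      then have "{1/4<..<3/4::real} \<in> null_sets lebesgue"
        by (subst AE_iff_null_sets) auto
      then have "emeasure lebesgue {1/4<..<3/4::real} = 0" by (rule null_setsD1)
      then show False by simp
    qed
    ultimately show ?thesis by simp
  qed
  define c where "c = (\<integral>x. w x * \<rho> x \<partial>unit_measure) / r"
  have bump0: "(\<integral>x. (w x - c) * bump a b n x \<partial>unit_measure) = 0" if "0 < a" "a < b" "b < 1" for a b n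
  proof -
    let ?\<eta> = "bump a b n"
    define s where "s = (\<integral>x. ?\<eta> x \<partial>unit_measure) / r"
    define \<psi> where "\<psi> x = ?\<eta> x + (- s) * \<rho> x" for x
    have \<psi>: "bump_algebra \<psi>"
      unfolding \<psi>_def[abs_def] by (intro bump_algebra.add bump_algebra_cmult bump_algebra_bump \<rho>)
    have "(\<integral>x. \<psi> x \<partial>unit_measure) = (\<integral>x. ?\<eta> x \<partial>unit_measure) + (- s) * r"
      unfolding \<psi>_def r_def using int[OF bump_algebra_bump] int[OF \<rho>] by simp
    then have mean: "(\<integral>x. \<psi> x \<partial>unit_measure) = 0" using \<open>r > 0\<close> by (simp add: s_def)
    have "\<exists>\<phi>. test_function \<phi> \<and> deriv \<phi> = \<psi>"
    proof (rule test_function_primitive[OF \<psi> _ _ _ _ mean])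
      fix x assume "x \<notin> {min a (1/4)..max b (3/4)}"
      then have "x \<notin> {a..b}" "x \<notin> {1/4..3/4}" by auto
      then show "\<psi> x = 0" unfolding \<psi>_def \<rho>_def by (simp add: bump_support)
    qed (use that in auto)
    then have "(\<integral>x. w x * \<psi> x \<partial>unit_measure) = 0" using orth by auto
    moreover have "(\<integral>x. w x * \<psi> x \<partial>unit_measure)
        = (\<integral>x. w x * ?\<eta> x + (- s) * (w x * \<rho> x) \<partial>unit_measure)"
      by (rule integral_unit_cong) (simp add: \<psi>_def algebra_simps)
    moreover have "\<dots> = (\<integral>x. w x * ?\<eta> x \<partial>unit_measure) + (- s) * (\<integral>x. w x * \<rho> x \<partial>unit_measure)"
      using wint[OF bump_algebra_bump] wint[OF \<rho>] by simp
    ultimately have "(\<integral>x. w x * ?\<eta> x \<partial>unit_measure) = c * (\<integral>x. ?\<eta> x \<partial>unit_measure)"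
      by (simp add: s_def c_def)
    then show ?thesis
      unfolding left_diff_distrib using wint[OF bump_algebra_bump] int[OF bump_algebra_bump]
      by (subst Bochner_Integration.integral_diff) auto
  qed
  let ?z = "\<lambda>x. w x - c"
  have z: "integrable unit_measure ?z" using w by simp
  have "prim ?z a = prim ?z b" if ab: "0 < a" "a < b" "b < 1" for a b
  proof -
    have [measurable]: "w \<in> borel_measurable unit_measure"
      using w by (rule borel_measurable_integrable)
    have [measurable]: "bump a b n \<in> borel_measurable unit_measure" for n
      by (rule continuous_measurable_unit[OF bump_algebra_continuous[OF bump_algebra_bump]])
    have [measurable]: "indicator {a<..<b} \<in> borel_measurable unit_measure"
      by (rule borel_measurable_unitI) simp
    have "(\<lambda>n. \<integral>x. ?z x * bump a b n x \<partial>unit_measure) \<longlonglongrightarrow>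
        (\<integral>x. ?z x * indicator {a<..<b} x \<partial>unit_measure)"
    proof (rule integral_dominated_convergence[where w = "\<lambda>x. norm (?z x)"])
      show "AE x in unit_measure. norm (?z x * bump a b n x) \<le> norm (?z x)" for n
        using bump_bounds by (auto simp: abs_mult intro!: mult_left_le)
      show "AE x in unit_measure. (\<lambda>n. ?z x * bump a b n x) \<longlonglongrightarrow> ?z x * indicator {a<..<b} x"
        using ab by (auto intro!: tendsto_mult bump_tendsto)
    qed (use z in auto)
    then have "(\<integral>x. ?z x * indicator {a<..<b} x \<partial>unit_measure) = 0"
      unfolding bump0[OF ab] by (simp only: LIMSEQ_const_iff)
    moreover have "(\<integral>x. ?z x * indicator {a<..<b} x \<partial>unit_measure)
        = (\<integral>x. ?z x * indicator {a<..b} x \<partial>unit_measure)"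
    proof (rule integral_cong_AE)
      show "AE x in unit_measure. ?z x * indicator {a<..<b} x = ?z x * indicator {a<..b} x"
        using AE_unit_neq[of b] by eventually_elim (auto simp: indicator_def)
      show "(\<lambda>x. ?z x * indicator {a<..b} x) \<in> borel_measurable unit_measure"
        using integrable_indicator_unit[OF z] by (intro borel_measurable_integrable) auto
    qed measurable
    ultimately show ?thesis using prim_diff[OF z, of a b] ab by simp
  qed
  from AE_zero_of_prim_constant[OF z this] have "AE x in unit_measure. w x = c"
    by simp
  then show ?thesis by blast
qed

lemma weak_derivative_prim:
  fixes f :: "real \<Rightarrow> real"
  assumes f: "integrable unit_measure f"
  shows "weak_derivative (\<lambda>x. c + prim f x) f"
  unfolding weak_derivative_def
proof (intro allI impI)
  fix \<phi> assume \<phi>: "test_function \<phi>"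
  then have "\<phi> differentiable (at x)" "deriv \<phi> differentiable (at x)" for x
    unfolding test_function_def by (metis funpow_0, metis funpow_0 funpow_simps_right(2) o_apply funpow.simps(2))
  then have d: "(\<phi> has_real_derivative deriv \<phi> x) (at x)" and c: "continuous_on S (deriv \<phi>)" for x S
    by (auto simp: DERIV_deriv_iff_real_differentiable continuous_at_imp_continuous_on
        differentiable_imp_continuous_within)
  have "0 \<notin> closure {x. \<phi> x \<noteq> 0}" "1 \<notin> closure {x. \<phi> x \<noteq> 0}"
    using \<phi> unfolding test_function_def by auto
  then have 0: "\<phi> 0 = 0" "\<phi> 1 = 0" using closure_subset by force+
  have p: "prim (deriv \<phi>) x = \<phi> x" if "0 \<le> x" "x \<le> 1" for x
    using prim_FTC[OF c that d] 0 by simp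
  have g: "integrable unit_measure (deriv \<phi>)" using c by (rule integrable_continuous_unit)
  have g0: "(\<integral>x. deriv \<phi> x \<partial>unit_measure) = 0" using p[of 1] 0 by (simp add: prim_1)
  have gi: "integrable unit_measure (\<lambda>x. deriv \<phi> x * prim f x)"
    using g continuous_prim[OF f] by (rule integrable_times_continuous)
  have "(\<integral>x. (c + prim f x) * deriv \<phi> x \<partial>unit_measure)
      = (\<integral>x. c * deriv \<phi> x + deriv \<phi> x * prim f x \<partial>unit_measure)"
    by (rule integral_unit_cong) (simp add: algebra_simps)
  also have "\<dots> = (\<integral>x. deriv \<phi> x * prim f x \<partial>unit_measure)"
    using g gi g0 by simp
  also have "\<dots> = (\<integral>x. f x * (0 - prim (deriv \<phi>) x) \<partial>unit_measure)"
    unfolding prim_by_parts[OF f g] g0 ..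
  also have "\<dots> = (\<integral>x. - (f x * \<phi> x) \<partial>unit_measure)"
    by (rule integral_unit_cong) (simp add: p)
  finally show "(\<integral>x. (c + prim f x) * deriv \<phi> x \<partial>unit_measure) = - (\<integral>x. f x * \<phi> x \<partial>unit_measure)"
    by simp
qed

lemma H1_prim:
  assumes "square_integrable f" shows "H1 (\<lambda>x. c + prim f x) f"
  unfolding H1_def
proof (intro conjI)
  have f: "integrable unit_measure f" using assms by (rule square_integrable_integrable)
  show "square_integrable (\<lambda>x. c + prim f x)"
    by (intro square_integrable_continuous continuous_intros continuous_prim f)
  show "weak_derivative (\<lambda>x. c + prim f x) f" using f by (rule weak_derivative_prim)
qed (rule assms)

text \<open>A weakly differentiable function differs from the primitive of its weak derivative by a
  function that is orthogonal to all derivatives of test functions. From here on the two infima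
  range over square integrable \<open>f\<close> in the role of the derivative.\<close>
lemma H1_representation:
  assumes "H1 u f"
  shows "square_integrable f" "\<exists>c. AE x in unit_measure. u x = c + prim f x"
proof -
  show f: "square_integrable f" using assms unfolding H1_def by blast
  have fi: "integrable unit_measure f" using f by (rule square_integrable_integrable)
  have u: "integrable unit_measure u"
    using assms unfolding H1_def by (intro square_integrable_integrable) blast
  have p: "integrable unit_measure (prim f)"
    by (rule integrable_continuous_unit[OF continuous_prim[OF fi]])
  have "\<exists>c. AE x in unit_measure. u x - prim f x = c"
  proof (rule du_Bois_Reymond)
    fix \<phi> assume \<phi>: "test_function \<phi>"
    have "deriv \<phi> differentiable (at x)" for x
      using \<phi> unfolding test_function_def
      by (metis funpow_0 funpow.simps(2) o_apply)
    then have c: "continuous_on S (deriv \<phi>)" for S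
      by (simp add: continuous_at_imp_continuous_on differentiable_imp_continuous_within)
    have "(\<integral>x. u x * deriv \<phi> x \<partial>unit_measure) = (\<integral>x. (0 + prim f x) * deriv \<phi> x \<partial>unit_measure)"
      using assms weak_derivative_prim[OF fi, of 0] \<phi> unfolding H1_def weak_derivative_def by metis
    then show "(\<integral>x. (u x - prim f x) * deriv \<phi> x \<partial>unit_measure) = 0"
      unfolding left_diff_distrib
      using integrable_times_continuous[OF u c] integrable_times_continuous[OF p c]
      by (subst Bochner_Integration.integral_diff) auto
  qed (use u p in simp)
  then obtain c where "AE x in unit_measure. u x - prim f x = c" by blast
  then have "AE x in unit_measure. u x = c + prim f x" by eventually_elim simp
  then show "\<exists>c. AE x in unit_measure. u x = c + prim f x" by blast
qed

section \<open>Spectral gaps as constants in Poincare inequalities\<close>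

definition energy :: "(real \<Rightarrow> real) \<Rightarrow> (real \<Rightarrow> real) \<Rightarrow> real" where
  "energy h f = (\<integral>x. (f x)\<^sup>2 * h x \<partial>unit_measure)"

text \<open>The numerator and the denominator of both Rayleigh quotients as functionals of the derivative \<open>f\<close>.
  Passing from the square norm to the variance removes the constraint of mean zero together with the
  constant of integration.\<close>
definition variance :: "(real \<Rightarrow> real) \<Rightarrow> (real \<Rightarrow> real) \<Rightarrow> real" where
  "variance k f = (\<integral>x. (prim f x)\<^sup>2 * k x \<partial>unit_measure) - (\<integral>x. prim f x * k x \<partial>unit_measure)\<^sup>2"

definition density :: "(real \<Rightarrow> real) \<Rightarrow> bool" where
  "density k \<longleftrightarrow> continuous_on {0..1} k \<and> (\<forall>x. 0 < x \<longrightarrow> x < 1 \<longrightarrow> 0 < k x) \<and>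
     (\<integral>x. k x \<partial>unit_measure) = 1"

text \<open>The common form of the two eigenvalues: \<open>k = h\<close> gives \<open>mu1\<close> and \<open>k = 1\<close> gives \<open>sigma1\<close>.\<close>
definition spectral_gap :: "(real \<Rightarrow> real) \<Rightarrow> (real \<Rightarrow> real) \<Rightarrow> real" where
  "spectral_gap h k = Inf {energy h u' / (\<integral>x. (u x)\<^sup>2 * k x \<partial>unit_measure) | u u'.
     H1 u u' \<and> \<not> (AE x in unit_measure. u x = 0) \<and> (\<integral>x. u x * k x \<partial>unit_measure) = 0}"

lemma mu1_spectral_gap: "mu1 h = spectral_gap h h"
  by (simp add: mu1_def spectral_gap_def energy_def)

lemma sigma1_spectral_gap: "sigma1 h = spectral_gap h (\<lambda>x. 1)"
  by (simp add: sigma1_def spectral_gap_def energy_def)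

lemma density_1: "density (\<lambda>x. 1)"
  by (simp add: density_def)

lemma densityD:
  assumes "density k"
  shows "continuous_on {0..1} k" "\<And>x. 0 < x \<Longrightarrow> x < 1 \<Longrightarrow> 0 < k x" "(\<integral>x. k x \<partial>unit_measure) = 1"
    "\<And>x. 0 < x \<Longrightarrow> x < 1 \<Longrightarrow> 0 \<le> k x"
  using assms by (auto simp: density_def intro: less_imp_le)

lemma energy_integrable:
  assumes "square_integrable f" "continuous_on {0..1} h"
  shows "integrable unit_measure (\<lambda>x. (f x)\<^sup>2 * h x)"
  using assms by (intro integrable_times_continuous square_integrable_square)

lemma energy_nonneg:
  assumes "\<And>x. 0 < x \<Longrightarrow> x < 1 \<Longrightarrow> 0 \<le> h x" shows "0 \<le> energy h f"
  unfolding energy_def using assms by (intro integral_unit_nonneg) auto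

lemma variance_shift:
  assumes k: "density k" and f: "integrable unit_measure f"
  shows "(\<integral>x. (prim f x - c)\<^sup>2 * k x \<partial>unit_measure)
    = variance k f + (c - (\<integral>x. prim f x * k x \<partial>unit_measure))\<^sup>2"
proof -
  note [continuous_intros] = continuous_prim[OF f] densityD(1)[OF k]
  have i: "integrable unit_measure (\<lambda>x. (prim f x)\<^sup>2 * k x)" "integrable unit_measure (\<lambda>x. prim f x * k x)"
     "integrable unit_measure k"
    by (intro integrable_continuous_unit continuous_intros)+
  have "(\<integral>x. (prim f x - c)\<^sup>2 * k x \<partial>unit_measure)
      = (\<integral>x. (prim f x)\<^sup>2 * k x - 2 * c * (prim f x * k x) + c\<^sup>2 * k x \<partial>unit_measure)"
    by (rule integral_unit_cong) (simp add: power2_eq_square algebra_simps)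
  also have "\<dots> = (\<integral>x. (prim f x)\<^sup>2 * k x \<partial>unit_measure)
      - 2 * c * (\<integral>x. prim f x * k x \<partial>unit_measure) + c\<^sup>2"
    using i densityD(3)[OF k] by simp
  finally show ?thesis by (simp add: variance_def power2_diff)
qed

lemma variance_le:
  assumes "density k" "integrable unit_measure f"
  shows "variance k f \<le> (\<integral>x. (prim f x - c)\<^sup>2 * k x \<partial>unit_measure)"
  unfolding variance_shift[OF assms] by simp

lemma variance_eq:
  assumes "density k" "integrable unit_measure f"
  shows "variance k f = (\<integral>x. (prim f x - (\<integral>x. prim f x * k x \<partial>unit_measure))\<^sup>2 * k x \<partial>unit_measure)"
  unfolding variance_shift[OF assms] by simp

lemma variance_nonneg:
  assumes "density k" "integrable unit_measure f" shows "0 \<le> variance k f"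
  unfolding variance_eq[OF assms] using densityD(4)[OF assms(1)] by (intro integral_unit_nonneg) auto

lemma not_AE_unit_False: "\<not> (AE x in unit_measure. False)"
proof
  assume "AE x in unit_measure. False"
  then have "(\<integral>x. (1::real) \<partial>unit_measure) = (\<integral>x. 0 \<partial>unit_measure)"
    by (intro integral_cong_AE) auto
  then show False by simp
qed

text \<open>Together with its converse \<open>le_spectral_gap\<close> below, this characterises the spectral gap as the best
  constant in a Poincare inequality for all square integrable \<open>f\<close>. The rest of the proof uses the
  eigenvalues through these two lemmas only, so no eigenfunction has to exist.\<close>
lemma spectral_gap_le:
  assumes k: "density k" and h: "\<And>x. 0 < x \<Longrightarrow> x < 1 \<Longrightarrow> 0 \<le> h x" and f: "square_integrable f"
  shows "spectral_gap h k * variance k f \<le> energy h f"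
proof (cases "variance k f = 0")
  case True
  then show ?thesis using energy_nonneg[OF h] by simp
next
  case False
  have fi: "integrable unit_measure f" using f by (rule square_integrable_integrable)
  note [continuous_intros] = continuous_prim[OF fi] densityD(1)[OF k]
  have pos: "variance k f > 0" using False variance_nonneg[OF k fi] by simp
  define m where "m = (\<integral>x. prim f x * k x \<partial>unit_measure)"
  define v where "v x = - m + prim f x" for x
  have v: "H1 v f" unfolding v_def[abs_def] using f by (rule H1_prim)
  have var: "(\<integral>x. (v x)\<^sup>2 * k x \<partial>unit_measure) = variance k f"
    unfolding variance_eq[OF k fi] m_def[symmetric] v_def by (intro integral_unit_cong) simp
  have mean: "(\<integral>x. v x * k x \<partial>unit_measure) = 0"
  proof -
    have "integrable unit_measure (\<lambda>x. prim f x * k x)" "integrable unit_measure k"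
      by (intro integrable_continuous_unit continuous_intros)+
    then show ?thesis using densityD(3)[OF k]
      by (simp add: v_def left_diff_distrib m_def[symmetric])
  qed
  have nz: "\<not> (AE x in unit_measure. v x = 0)"
  proof
    assume "AE x in unit_measure. v x = 0"
    then have "AE x in unit_measure. (v x)\<^sup>2 * k x = 0" by eventually_elim simp
    then have "(\<integral>x. (v x)\<^sup>2 * k x \<partial>unit_measure) = 0" by (rule integral_eq_zero_AE)
    then show False using var pos by simp
  qed
  have "spectral_gap h k \<le> energy h f / variance k f"
    unfolding spectral_gap_def
  proof (rule cInf_lower)
    show "energy h f / variance k f \<in> {energy h u' / (\<integral>x. (u x)\<^sup>2 * k x \<partial>unit_measure) | u u'.
       H1 u u' \<and> \<not> (AE x in unit_measure. u x = 0) \<and> (\<integral>x. u x * k x \<partial>unit_measure) = 0}"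
      using v var mean nz by force
    have "0 \<le> energy h u' / (\<integral>x. (u x)\<^sup>2 * k x \<partial>unit_measure)" for u u'
      using energy_nonneg[OF h] densityD(4)[OF k]
      by (intro divide_nonneg_nonneg integral_unit_nonneg) auto
    then show "bdd_below {energy h u' / (\<integral>x. (u x)\<^sup>2 * k x \<partial>unit_measure) | u u'.
       H1 u u' \<and> \<not> (AE x in unit_measure. u x = 0) \<and> (\<integral>x. u x * k x \<partial>unit_measure) = 0}"
      by (intro bdd_belowI[of _ 0]) auto
  qed
  then show ?thesis using pos by (simp add: pos_le_divide_eq)
qed

lemma H1_variance:
  assumes k: "density k" and u: "H1 u f" "\<not> (AE x in unit_measure. u x = 0)"
    "(\<integral>x. u x * k x \<partial>unit_measure) = 0"
  shows "(\<integral>x. (u x)\<^sup>2 * k x \<partial>unit_measure) = variance k f" "variance k f > 0"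
proof -
  have f: "square_integrable f" using H1_representation(1)[OF u(1)] .
  have fi: "integrable unit_measure f" using f by (rule square_integrable_integrable)
  obtain c where c: "AE x in unit_measure. u x = c + prim f x"
    using H1_representation(2)[OF u(1)] by blast
  have usq: "square_integrable u" using u(1) by (simp add: H1_def)
  have ui: "integrable unit_measure (\<lambda>x. u x * k x)" "integrable unit_measure (\<lambda>x. (u x)\<^sup>2 * k x)"
    using integrable_times_continuous[OF square_integrable_integrable[OF usq] densityD(1)[OF k]]
      integrable_times_continuous[OF square_integrable_square[OF usq] densityD(1)[OF k]] by auto
  note [continuous_intros] = continuous_prim[OF fi] densityD(1)[OF k]
  have i: "integrable unit_measure (\<lambda>x. prim f x * k x)" "integrable unit_measure k"
    by (intro integrable_continuous_unit continuous_intros)+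
  have m: "integrable unit_measure (\<lambda>x. (c + prim f x) * k x)" "integrable unit_measure (\<lambda>x. (prim f x + c)\<^sup>2 * k x)"
    by (intro integrable_continuous_unit continuous_intros)+
  have "0 = (\<integral>x. u x * k x \<partial>unit_measure)" using u(3) by simp
  also have "\<dots> = (\<integral>x. (c + prim f x) * k x \<partial>unit_measure)"
    by (rule integral_cong_AE) (use c ui m in \<open>auto intro: borel_measurable_integrable\<close>)
  also have "\<dots> = c + (\<integral>x. prim f x * k x \<partial>unit_measure)"
    using i densityD(3)[OF k] by (simp add: distrib_right)
  finally have c': "- c = (\<integral>x. prim f x * k x \<partial>unit_measure)" by simp
  have c2: "AE x in unit_measure. (u x)\<^sup>2 * k x = (prim f x + c)\<^sup>2 * k x"
    using c by eventually_elim (simp add: add.commute)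
  have "(\<integral>x. (u x)\<^sup>2 * k x \<partial>unit_measure) = (\<integral>x. (prim f x + c)\<^sup>2 * k x \<partial>unit_measure)"
    by (rule integral_cong_AE[OF _ _ c2]) (use ui m in \<open>auto intro: borel_measurable_integrable\<close>)
  then show eq: "(\<integral>x. (u x)\<^sup>2 * k x \<partial>unit_measure) = variance k f"
    unfolding variance_eq[OF k fi] c'[symmetric] by simp
  have "variance k f \<noteq> 0"
  proof
    assume "variance k f = 0"
    then have "AE x in unit_measure. (u x)\<^sup>2 * k x = 0"
      using eq by (intro iffD1[OF integral_nonneg_eq_0_iff_AE[OF ui(2)]] AE_I2)
        (use densityD(4)[OF k] in auto)
    moreover have "AE x in unit_measure. 0 < k x"
      by (rule AE_I2) (use densityD(2)[OF k] in auto)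
    ultimately have "AE x in unit_measure. u x = 0" by eventually_elim auto
    then show False using u(2) by simp
  qed
  then show "variance k f > 0" using variance_nonneg[OF k fi] by simp
qed

text \<open>The infimum of the empty set would be unspecified, so a competitor has to be exhibited: the
  identity function minus its mean.\<close>
lemma le_spectral_gap:
  assumes k: "density k"
    and B: "\<And>f. square_integrable f \<Longrightarrow> B * variance k f \<le> energy h f"
  shows "B \<le> spectral_gap h k"
  unfolding spectral_gap_def
proof (rule cInf_greatest)
  have f: "square_integrable (\<lambda>x. 1)" by (rule square_integrable_const)
  define m where "m = (\<integral>x. prim (\<lambda>x. 1) x * k x \<partial>unit_measure)"
  have "\<not> (AE x in unit_measure. - m + prim (\<lambda>x. 1) x = 0)"
  proof
    assume "AE x in unit_measure. - m + prim (\<lambda>x. 1) x = 0"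
    moreover have "AE x in unit_measure. prim (\<lambda>x. 1) x = x"
      by (rule AE_I2) (auto simp: prim_const)
    ultimately have "AE x in unit_measure. False"
      using AE_unit_neq[of m] by eventually_elim auto
    then show False using not_AE_unit_False by simp
  qed
  moreover have "(\<integral>x. (- m + prim (\<lambda>x. 1) x) * k x \<partial>unit_measure) = 0"
  proof -
    note [continuous_intros] = continuous_prim[OF square_integrable_integrable[OF f]] densityD(1)[OF k]
    have "integrable unit_measure (\<lambda>x. prim (\<lambda>x. 1) x * k x)" "integrable unit_measure k"
      by (intro integrable_continuous_unit continuous_intros)+
    then show ?thesis using densityD(3)[OF k]
      by (simp add: left_diff_distrib m_def[symmetric])
  qed
  ultimately show "{energy h u' / (\<integral>x. (u x)\<^sup>2 * k x \<partial>unit_measure) | u u'.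
     H1 u u' \<and> \<not> (AE x in unit_measure. u x = 0) \<and> (\<integral>x. u x * k x \<partial>unit_measure) = 0} \<noteq> {}"
    using H1_prim[OF f, of "- m"] by blast
  fix r assume "r \<in> {energy h u' / (\<integral>x. (u x)\<^sup>2 * k x \<partial>unit_measure) | u u'.
     H1 u u' \<and> \<not> (AE x in unit_measure. u x = 0) \<and> (\<integral>x. u x * k x \<partial>unit_measure) = 0}"
  then obtain u f where r: "r = energy h f / (\<integral>x. (u x)\<^sup>2 * k x \<partial>unit_measure)"
    and u: "H1 u f" "\<not> (AE x in unit_measure. u x = 0)" "(\<integral>x. u x * k x \<partial>unit_measure) = 0"
    by blast
  show "B \<le> r"
    unfolding r H1_variance(1)[OF k u]
    using H1_variance(2)[OF k u] B[OF H1_representation(1)[OF u(1)]]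
    by (simp add: pos_le_divide_eq)
qed

lemma prim_diff_abs_le:
  fixes f :: "real \<Rightarrow> real"
  assumes f: "integrable unit_measure f"
  shows "\<bar>prim f y - prim f x\<bar> \<le> \<bar>prim (\<lambda>t. \<bar>f t\<bar>) y - prim (\<lambda>t. \<bar>f t\<bar>) x\<bar>"
proof -
  have *: "\<bar>prim f y - prim f x\<bar> \<le> prim (\<lambda>t. \<bar>f t\<bar>) y - prim (\<lambda>t. \<bar>f t\<bar>) x" if "x \<le> y" for x y
  proof -
    have a: "integrable unit_measure (\<lambda>t. \<bar>f t\<bar>)" using f by simp
    have "\<bar>\<integral>t. f t * indicator {x<..y} t \<partial>unit_measure\<bar>
        \<le> (\<integral>t. \<bar>f t * indicator {x<..y} t\<bar> \<partial>unit_measure)"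
      by (rule integral_abs_bound)
    also have "\<dots> = (\<integral>t. \<bar>f t\<bar> * indicator {x<..y} t \<partial>unit_measure)"
      by (simp add: abs_mult)
    finally show ?thesis
      unfolding prim_diff[OF f that] prim_diff[OF a that] .
  qed
  show ?thesis
  proof (cases "x \<le> y")
    case True
    then show ?thesis using *[OF True] by linarith
  next
    case False
    then show ?thesis using *[of y x] by linarith
  qed
qed

text \<open>The mean lies between the extreme values, so the intermediate value theorem applies.\<close>
lemma mean_value_attained:
  assumes k: "density k" and g: "continuous_on {0..1} g"
  shows "\<exists>x\<in>{0..1}. g x = (\<integral>x. g x * k x \<partial>unit_measure)"
proof -
  obtain a where a: "a \<in> {0..1}" "\<And>x. x \<in> {0..1} \<Longrightarrow> g a \<le> g x"
    using continuous_attains_inf[OF _ _ g] by auto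
  obtain b where b: "b \<in> {0..1}" "\<And>x. x \<in> {0..1} \<Longrightarrow> g x \<le> g b"
    using continuous_attains_sup[OF _ _ g] by auto
  note [continuous_intros] = densityD(1)[OF k] g
  have i: "integrable unit_measure (\<lambda>x. g x * k x)" "integrable unit_measure k"
    by (intro integrable_continuous_unit continuous_intros)+
  have "(\<integral>x. g a * k x \<partial>unit_measure) \<le> (\<integral>x. g x * k x \<partial>unit_measure)"
    using i a densityD(4)[OF k] by (intro integral_unit_mono mult_right_mono) auto
  moreover have "(\<integral>x. g x * k x \<partial>unit_measure) \<le> (\<integral>x. g b * k x \<partial>unit_measure)"
    using i b densityD(4)[OF k] by (intro integral_unit_mono mult_right_mono) auto
  ultimately have "(\<integral>x. g x * k x \<partial>unit_measure) \<in> {g a..g b}"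
    using densityD(3)[OF k] by simp
  moreover have "{g a..g b} \<subseteq> g ` {0..1}"
    using connected_continuous_image[OF g connected_Icc] a b by (intro connected_contains_Icc) auto
  ultimately show ?thesis by force
qed

text \<open>Replacing the derivative by its absolute value makes the function monotone and increases all its
  oscillations. Measuring the variance of \<open>prim f\<close> from a point where the larger function takes its mean
  compares the two by a pointwise estimate.\<close>
lemma variance_abs:
  assumes k: "density k" and f: "integrable unit_measure f"
  shows "variance k f \<le> variance k (\<lambda>x. \<bar>f x\<bar>)"
proof -
  let ?a = "\<lambda>x. \<bar>f x\<bar>"
  have a: "integrable unit_measure ?a" using f by simp
  obtain x0 where x0: "prim ?a x0 = (\<integral>x. prim ?a x * k x \<partial>unit_measure)"
    using mean_value_attained[OF k continuous_prim[OF a]] by blast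
  note [continuous_intros] = densityD(1)[OF k] continuous_prim[OF a] continuous_prim[OF f]
  have "variance k f \<le> (\<integral>x. (prim f x - prim f x0)\<^sup>2 * k x \<partial>unit_measure)"
    by (rule variance_le[OF k f])
  also have "\<dots> \<le> (\<integral>x. (prim ?a x - prim ?a x0)\<^sup>2 * k x \<partial>unit_measure)"
  proof (rule integral_unit_mono)
    fix x :: real assume "0 < x" "x < 1"
    then show "(prim f x - prim f x0)\<^sup>2 * k x \<le> (prim ?a x - prim ?a x0)\<^sup>2 * k x"
      using densityD(4)[OF k] prim_diff_abs_le[OF f, of x x0]
      by (intro mult_right_mono) (auto simp: abs_le_square_iff)
  qed (intro integrable_continuous_unit continuous_intros)+
  also have "\<dots> = variance k ?a" unfolding variance_eq[OF k a] x0 ..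
  finally show ?thesis .
qed

section \<open>Moments and the unweighted variance\<close>

text \<open>Up to a factor this is the flux \<open>h v'\<close> of an eigenfunction \<open>v\<close> of \<open>-(h v')' = \<sigma> v\<close>: integrating the equation
  from \<open>0\<close> shows that \<open>h v'\<close> is \<open>\<sigma>\<close> times the moment of \<open>v'\<close>. It vanishes at both ends of the interval and represents the
  variance as a pairing with the derivative.\<close>
definition moment :: "(real \<Rightarrow> real) \<Rightarrow> real \<Rightarrow> real" where
  "moment f = prim (\<lambda>x. (\<integral>x. prim f x \<partial>unit_measure) - prim f x)"

lemma continuous_moment:
  assumes f: "integrable unit_measure f" shows "continuous_on {0..1} (moment f)"
  unfolding moment_def
  by (intro continuous_prim integrable_continuous_unit continuous_intros f)

lemma moment_by_parts:
  assumes f: "integrable unit_measure f" and w: "integrable unit_measure w"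
  shows "(\<integral>x. (prim f x - (\<integral>x. prim f x \<partial>unit_measure)) * prim w x \<partial>unit_measure)
    = (\<integral>x. w x * moment f x \<partial>unit_measure)"
proof -
  let ?m = "\<integral>x. prim f x \<partial>unit_measure"
  let ?v = "\<lambda>x. prim f x - ?m"
  have p: "integrable unit_measure (prim f)"
    by (intro integrable_continuous_unit continuous_prim f)
  then have v: "integrable unit_measure ?v" by simp
  have v0: "(\<integral>x. ?v x \<partial>unit_measure) = 0" using p by simp
  have "prim (\<lambda>x. (-1) * ?v x) y = (-1) * prim ?v y" for y by (rule prim_cmult)
  then have "moment f y = 0 - prim ?v y" for y unfolding moment_def by simp
  then show ?thesis unfolding prim_by_parts[OF w v] v0 by simp
qed

lemma variance_moment:
  assumes f: "integrable unit_measure f"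
  shows "variance (\<lambda>x. 1) f = (\<integral>x. f x * moment f x \<partial>unit_measure)"
proof -
  let ?m = "\<integral>x. prim f x \<partial>unit_measure"
  note [continuous_intros] = continuous_prim[OF f]
  have i: "integrable unit_measure (\<lambda>x. (prim f x)\<^sup>2)" "integrable unit_measure (prim f)"
    by (intro integrable_continuous_unit continuous_intros)+
  have "(\<integral>x. (prim f x - ?m) * prim f x \<partial>unit_measure) = (\<integral>x. (prim f x)\<^sup>2 - ?m * prim f x \<partial>unit_measure)"
    by (rule integral_unit_cong) (simp add: power2_eq_square algebra_simps)
  also have "\<dots> = variance (\<lambda>x. 1) f" using i by (simp add: variance_def power2_eq_square)
  finally show ?thesis unfolding moment_by_parts[OF f f] by simp
qed

text \<open>The first variation of the unweighted variance is the moment.\<close>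
lemma variance_perturb:
  assumes f: "integrable unit_measure f" and w: "integrable unit_measure w"
  shows "variance (\<lambda>x. 1) (\<lambda>x. f x + t * w x)
    = variance (\<lambda>x. 1) f + 2 * t * (\<integral>x. w x * moment f x \<partial>unit_measure) + t\<^sup>2 * variance (\<lambda>x. 1) w"
proof -
  let ?m = "\<integral>x. prim f x \<partial>unit_measure"
  note [continuous_intros] = continuous_prim[OF f] continuous_prim[OF w]
  have i: "integrable unit_measure (\<lambda>x. (prim f x)\<^sup>2)" "integrable unit_measure (prim f)"
     "integrable unit_measure (\<lambda>x. (prim w x)\<^sup>2)" "integrable unit_measure (prim w)"
     "integrable unit_measure (\<lambda>x. prim f x * prim w x)"
    by (intro integrable_continuous_unit continuous_intros)+
  have p: "prim (\<lambda>x. f x + t * w x) x = prim f x + t * prim w x" for x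
    using f w by (simp add: prim_add prim_cmult)
  have "(\<integral>x. (prim f x + t * prim w x)\<^sup>2 \<partial>unit_measure)
      = (\<integral>x. (prim f x)\<^sup>2 + 2 * t * (prim f x * prim w x) + t\<^sup>2 * (prim w x)\<^sup>2 \<partial>unit_measure)"
    by (rule integral_unit_cong) (simp add: power2_eq_square algebra_simps)
  also have "\<dots> = (\<integral>x. (prim f x)\<^sup>2 \<partial>unit_measure) + 2 * t * (\<integral>x. prim f x * prim w x \<partial>unit_measure)
      + t\<^sup>2 * (\<integral>x. (prim w x)\<^sup>2 \<partial>unit_measure)"
    using i by simp
  finally have a: "(\<integral>x. (prim f x + t * prim w x)\<^sup>2 \<partial>unit_measure) = \<dots>" .
  have b: "(\<integral>x. prim f x + t * prim w x \<partial>unit_measure) = ?m + t * (\<integral>x. prim w x \<partial>unit_measure)"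
    using i by simp
  have c: "(\<integral>x. w x * moment f x \<partial>unit_measure)
      = (\<integral>x. prim f x * prim w x \<partial>unit_measure) - ?m * (\<integral>x. prim w x \<partial>unit_measure)"
    unfolding moment_by_parts[OF f w, symmetric] left_diff_distrib using i by simp
  show ?thesis
    unfolding variance_def p c mult_1_right a b by (simp add: power2_eq_square algebra_simps)
qed

lemma energy_perturb:
  assumes h: "continuous_on {0..1} h" and f: "square_integrable f" and w: "square_integrable w"
  shows "energy h (\<lambda>x. f x + t * w x)
    = energy h f + 2 * t * (\<integral>x. f x * w x * h x \<partial>unit_measure) + t\<^sup>2 * energy h w"
proof -
  have i: "integrable unit_measure (\<lambda>x. (f x)\<^sup>2 * h x)" "integrable unit_measure (\<lambda>x. (w x)\<^sup>2 * h x)"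
     "integrable unit_measure (\<lambda>x. f x * w x * h x)"
    using f w h by (auto intro: energy_integrable integrable_times_continuous square_integrable_prod)
  have "energy h (\<lambda>x. f x + t * w x)
      = (\<integral>x. (f x)\<^sup>2 * h x + 2 * t * (f x * w x * h x) + t\<^sup>2 * ((w x)\<^sup>2 * h x) \<partial>unit_measure)"
    unfolding energy_def by (rule integral_unit_cong) (simp add: power2_eq_square algebra_simps)
  then show ?thesis using i by (simp add: energy_def)
qed

text \<open>The moment at \<open>y\<close> is the integral of a function of mean zero over \<open>{0..y}\<close> and, up to sign, over
  \<open>{y..1}\<close>. The Cauchy-Schwarz inequality on the shorter of the two gives a bound that vanishes at
  both ends at the rate of \<open>y(1-y)\<close>, the rate at which concave weights may vanish.\<close>
lemma moment_bound:
  assumes f: "integrable unit_measure f" and y: "0 \<le> y" "y \<le> 1"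
  shows "(moment f y)\<^sup>2 \<le> 2 * (y * (1 - y)) * variance (\<lambda>x. 1) f"
proof -
  let ?m = "\<integral>x. prim f x \<partial>unit_measure"
  let ?v = "\<lambda>x. ?m - prim f x"
  let ?S = "variance (\<lambda>x. 1) f"
  note [continuous_intros] = continuous_prim[OF f]
  have v: "integrable unit_measure ?v" and v2: "integrable unit_measure (\<lambda>x. (?v x)\<^sup>2)"
    by (intro integrable_continuous_unit continuous_intros)+
  have S: "?S = (\<integral>x. (?v x)\<^sup>2 \<partial>unit_measure)"
    using variance_eq[OF density_1 f] by (simp add: power2_commute)
  have v0: "prim ?v 1 = 0"
  proof -
    have "integrable unit_measure (prim f)" by (intro integrable_continuous_unit continuous_intros)
    then show ?thesis by (simp add: prim_1)
  qed
  have CS: "(prim ?v b - prim ?v a)\<^sup>2 \<le> (b - a) * ?S" if "0 \<le> a" "a \<le> b" "b \<le> 1" for a b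
  proof (cases "a = b")
    case True then show ?thesis by simp
  next
    case False
    define I where "I = prim ?v b - prim ?v a"
    have I: "I = (\<integral>t. ?v t * indicator {a<..b} t \<partial>unit_measure)"
      unfolding I_def by (rule prim_diff[OF v that(2)])
    have one: "(\<integral>t. indicator {a<..b} t \<partial>unit_measure) = b - a"
      using prim_diff[of "\<lambda>x. 1" a b] that by (simp add: prim_const)
    have ii: "integrable unit_measure (\<lambda>t. indicator {a<..b} t :: real)"
      using integrable_indicator_unit[of "\<lambda>x. 1" "{a<..b}"] by simp
    \<comment> \<open>Cauchy-Schwarz: subtract the best constant on the interval from the function\<close>
    let ?c = "I / (b - a)"
    have "0 \<le> (\<integral>t. (?v t)\<^sup>2 - 2 * ?c * (?v t * indicator {a<..b} t) + ?c\<^sup>2 * indicator {a<..b} t \<partial>unit_measure)"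
    proof (rule integral_unit_nonneg)
      have "0 \<le> v\<^sup>2 - 2 * c * v + c\<^sup>2" for v c :: real
        using zero_le_power2[of "v - c"] by (simp add: power2_diff algebra_simps)
      then show "0 \<le> (?v t)\<^sup>2 - 2 * ?c * (?v t * indicator {a<..b} t) + ?c\<^sup>2 * indicator {a<..b} t"
        for t
        by (cases "t \<in> {a<..b}") (simp_all only: indicator_simps mult_1_right mult_zero_right, simp_all)
    qed
    also have "\<dots> = ?S - 2 * ?c * I + ?c\<^sup>2 * (b - a)"
      unfolding S I using v2 integrable_indicator_unit[OF v] ii one by simp
    also have "\<dots> = ?S - I\<^sup>2 / (b - a)"
    proof -
      define d where "d = b - a"
      have "d \<noteq> 0" using False by (simp add: d_def)
      then show ?thesis unfolding d_def[symmetric] by (simp add: power2_eq_square field_simps)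
    qed
    finally show ?thesis
      unfolding I_def[symmetric] using False that by (simp add: pos_divide_le_eq mult.commute)
  qed
  have "(moment f y)\<^sup>2 \<le> y * ?S"
    using CS[of 0 y] y by (simp add: moment_def prim_0)
  moreover have "(moment f y)\<^sup>2 \<le> (1 - y) * ?S"
    using CS[of y 1] y by (simp add: moment_def v0)
  moreover have "min y (1 - y) \<le> 2 * q" if q: "q = y * (1 - y)" for q
  proof (cases "y \<le> 1/2")
    case True
    then have "y * (1/2) \<le> q" unfolding q using y by (intro mult_left_mono) auto
    then show ?thesis by linarith
  next
    case False
    then have "(1 - y) * (1/2) \<le> (1 - y) * y" using y by (intro mult_left_mono) auto
    then show ?thesis using q by (simp add: mult.commute)
  qed
  then have "min y (1 - y) * ?S \<le> 2 * (y * (1 - y)) * ?S"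
    using variance_nonneg[OF density_1 f] by (intro mult_right_mono) auto
  ultimately show ?thesis by (cases "y \<le> 1 - y") (auto simp: min_def)
qed

text \<open>If \<open>f\<close> is non-negative, its primitive increases, so the moment is a concave function that
  vanishes at \<open>0\<close> and \<open>1\<close>. A non-negative concave function cannot be small at one inner point
  without being small everywhere.\<close>
lemma moment_chord:
  assumes f: "integrable unit_measure f" and pos: "\<And>x. 0 < x \<Longrightarrow> x < 1 \<Longrightarrow> 0 \<le> f x"
    and yz: "0 \<le> y" "y \<le> 1" "0 \<le> z" "z \<le> 1"
  shows "y * (1 - y) * moment f z \<le> moment f y"
proof -
  let ?m = "\<integral>x. prim f x \<partial>unit_measure"
  let ?v = "\<lambda>x. ?m - prim f x"
  note [continuous_intros] = continuous_prim[OF f]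
  have v: "integrable unit_measure ?v" and p: "integrable unit_measure (prim f)"
    by (intro integrable_continuous_unit continuous_intros)+
  have M: "moment f 0 = 0" "moment f 1 = 0" unfolding moment_def
    using p by (simp_all add: prim_0 prim_1)
  have ic: "integrable unit_measure (\<lambda>x. c)" for c :: real by simp
  \<comment> \<open>\<open>?v\<close> is decreasing and is the derivative of the moment, so chords lie between its end values\<close>
  have slope: "moment f b - moment f a \<ge> (b - a) * ?v b" "moment f b - moment f a \<le> (b - a) * ?v a"
    if "0 \<le> a" "a \<le> b" "b \<le> 1" for a b
  proof -
    have *: "prim (\<lambda>x. ?v b) b - prim (\<lambda>x. ?v b) a \<le> moment f b - moment f a"
      unfolding moment_def prim_diff[OF ic that(2)] prim_diff[OF v that(2)]
    proof (rule integral_unit_mono)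
      fix t :: real assume "0 < t" "t < 1"
      then show "?v b * indicator {a<..b} t \<le> ?v t * indicator {a<..b} t"
        using prim_mono[OF f _ pos, of t b] by (auto simp: indicator_def)
    qed (rule integrable_indicator_unit[OF ic] integrable_indicator_unit[OF v], simp)+
    then show "moment f b - moment f a \<ge> (b - a) * ?v b"
      using that by (simp add: prim_const algebra_simps)
    have *: "moment f b - moment f a \<le> prim (\<lambda>x. ?v a) b - prim (\<lambda>x. ?v a) a"
      unfolding moment_def prim_diff[OF ic that(2)] prim_diff[OF v that(2)]
    proof (rule integral_unit_mono)
      fix t :: real assume "0 < t" "t < 1"
      then show "?v t * indicator {a<..b} t \<le> ?v a * indicator {a<..b} t"
        using prim_mono[OF f _ pos, of a t] by (auto simp: indicator_def)
    qed (rule integrable_indicator_unit[OF ic] integrable_indicator_unit[OF v], simp)+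
    then show "moment f b - moment f a \<le> (b - a) * ?v a"
      using that by (simp add: prim_const algebra_simps)
  qed
  have nonneg: "0 \<le> moment f y" if "0 \<le> y" "y \<le> 1" for y
  proof (cases "?v y \<ge> 0")
    case True
    then have "0 \<le> y * ?v y" using that by simp
    then show ?thesis using slope(1)[of 0 y] M that by simp
  next
    case False
    then have "(1 - y) * ?v y \<le> 0" using that by (simp add: mult_nonneg_nonpos)
    then show ?thesis using slope(2)[of y 1] M that by simp
  qed
  have left: "y * moment f z \<le> moment f y" if "y \<le> z"
  proof -
    have 1: "y * ?v y \<le> moment f y" using slope(1)[of 0 y] M yz by simp
    have 2: "moment f z - moment f y \<le> (z - y) * ?v y" using slope(2)[of y z] yz that by simp
    have "y * (moment f z - moment f y) \<le> (z - y) * (y * ?v y)"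
      using mult_left_mono[OF 2 yz(1)] by (simp add: algebra_simps)
    also have "\<dots> \<le> (z - y) * moment f y" using 1 that by (intro mult_left_mono) auto
    finally have "y * moment f z \<le> z * moment f y" by (simp add: algebra_simps)
    also have "\<dots> \<le> 1 * moment f y" using nonneg yz by (intro mult_right_mono) auto
    finally show ?thesis by simp
  qed
  have right: "(1 - y) * moment f z \<le> moment f y" if "z \<le> y"
  proof -
    have 1: "- ((1 - y) * ?v y) \<le> moment f y" using slope(2)[of y 1] M yz by simp
    have 2: "(y - z) * ?v y \<le> moment f y - moment f z" using slope(1)[of z y] yz that by simp
    have "(1 - y) * (moment f z - moment f y) \<le> (1 - y) * (- ((y - z) * ?v y))"
      using 2 yz by (intro mult_left_mono) auto
    also have "\<dots> = (y - z) * (- ((1 - y) * ?v y))" by (simp add: algebra_simps)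
    also have "\<dots> \<le> (y - z) * moment f y" using 1 that by (intro mult_left_mono) auto
    finally have "(1 - y) * moment f z \<le> (1 - z) * moment f y" by (simp add: algebra_simps)
    also have "\<dots> \<le> 1 * moment f y" using nonneg yz by (intro mult_right_mono) auto
    finally show ?thesis by simp
  qed
  show ?thesis
  proof (cases "y \<le> z")
    case True
    have "(1 - y) * (y * moment f z) \<le> 1 * (y * moment f z)"
      using nonneg[OF yz(3,4)] yz by (intro mult_right_mono) auto
    then show ?thesis using left[OF True] by (simp add: mult_ac)
  next
    case False
    have "y * ((1 - y) * moment f z) \<le> 1 * ((1 - y) * moment f z)"
      using nonneg[OF yz(3,4)] yz by (intro mult_right_mono) auto
    then show ?thesis using right False by (simp add: mult_ac)
  qed
qed

section \<open>Concave weights of unit mass\<close>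

locale unit_weight =
  fixes h :: "real \<Rightarrow> real"
  assumes weight: "h \<in> weights1"
begin

lemma continuous_h: "continuous_on {0..1} h"
  and concave_h: "concave_on {0..1} h"
  and h_nonneg: "0 \<le> x \<Longrightarrow> x \<le> 1 \<Longrightarrow> 0 \<le> h x"
  and integral_h: "(\<integral>x. h x \<partial>unit_measure) = 1"
  using weight by (auto simp: weights1_def weights_def)

lemma integrable_h: "integrable unit_measure h"
  by (rule integrable_continuous_unit[OF continuous_h])

lemma chord:
  assumes "0 \<le> a" "a \<le> x" "x \<le> b" "b \<le> 1"
  shows "(b - x) * h a + (x - a) * h b \<le> (b - a) * h x"
proof (cases "a = b")
  case True
  then show ?thesis using assms by simp
next
  case False
  then have d: "b - a > 0" using assms by simp
  define t where "t = (x - a) / (b - a)"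
  have t: "0 \<le> t" "t \<le> 1" "t * (b - a) = x - a" using assms d by (auto simp: t_def)
  have "(1 - t) * h a + t * h b \<le> h ((1 - t) *\<^sub>R a + t *\<^sub>R b)"
    using concave_onD[OF concave_h t(1,2), of a b] assms by simp
  moreover have "(1 - t) *\<^sub>R a + t *\<^sub>R b = x" using t(3) by (simp add: algebra_simps)
  ultimately have "(b - a) * ((1 - t) * h a + t * h b) \<le> (b - a) * h x"
    using d by simp
  moreover have "(b - a) * ((1 - t) * h a + t * h b) = ((b - a) - t * (b - a)) * h a + t * (b - a) * h b"
    by (simp add: algebra_simps)
  ultimately show ?thesis unfolding t(3) by simp
qed

lemma chord_left:
  assumes "0 \<le> x" "x \<le> y" "y \<le> 1" shows "x * h y \<le> y * h x"
proof -
  have "0 \<le> (y - x) * h 0" using assms h_nonneg[of 0] by (intro mult_nonneg_nonneg) auto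
  moreover have "(y - x) * h 0 + x * h y \<le> y * h x" using chord[of 0 x y] assms by simp
  ultimately show ?thesis by linarith
qed

lemma chord_right:
  assumes "0 \<le> y" "y \<le> x" "x \<le> 1" shows "(1 - x) * h y \<le> (1 - y) * h x"
proof -
  have "0 \<le> (x - y) * h 1" using assms h_nonneg[of 1] by (intro mult_nonneg_nonneg) auto
  moreover have "(1 - x) * h y + (x - y) * h 1 \<le> (1 - y) * h x" using chord[of y x 1] assms by simp
  ultimately show ?thesis by linarith
qed

abbreviation H :: "real \<Rightarrow> real" where "H \<equiv> prim h"

lemma H_0: "H 0 = 0" and H_1: "H 1 = 1"
  by (simp_all add: prim_0 prim_1 integral_h)

lemma continuous_H: "continuous_on {0..1} H"
  by (rule continuous_prim[OF integrable_h])

text \<open>The graph of a concave function lies above its chord.\<close>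
lemma trapezoid:
  assumes "0 \<le> a" "a \<le> b" "b \<le> 1"
  shows "(b - a) * (h a + h b) / 2 \<le> H b - H a"
proof (cases "a = b")
  case False
  then have d: "b - a > 0" using assms by simp
  define s where "s = (h b - h a) / (b - a)"
  have s: "s * (b - a) = h b - h a" using d by (simp add: s_def)
  define L where "L x = h a + s * (x - a)" for x
  define F where "F x = h a * x + s * (x - a)\<^sup>2 / 2" for x
  have cL: "continuous_on {0..1} L" unfolding L_def by (intro continuous_intros)
  have F: "(F has_real_derivative L x) (at x)" for x
    unfolding F_def L_def by (auto intro!: derivative_eq_intros)
  have iL: "integrable unit_measure L" by (rule integrable_continuous_unit[OF cL])
  have "prim L b - prim L a = F b - F a"
    using assms prim_FTC[OF cL _ _ F, of a] prim_FTC[OF cL _ _ F, of b] by simp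
  also have "\<dots> = (b - a) * (h a + (h a + s * (b - a))) / 2"
    by (simp add: F_def power2_eq_square field_simps)
  also have "\<dots> = (b - a) * (h a + h b) / 2" unfolding s by simp
  finally have "(b - a) * (h a + h b) / 2 = prim L b - prim L a" ..
  also have "\<dots> \<le> H b - H a"
    unfolding prim_diff[OF iL assms(2)] prim_diff[OF integrable_h assms(2)]
  proof (rule integral_unit_mono)
    fix t :: real assume "0 < t" "t < 1"
    have "L t \<le> h t" if "a < t" "t \<le> b"
    proof -
      have "(b - a) * L t = (b - a) * h a + s * (b - a) * (t - a)"
        by (simp add: L_def algebra_simps)
      also have "\<dots> = (b - t) * h a + (t - a) * h b"
        unfolding s by (simp add: algebra_simps)
      also have "\<dots> \<le> (b - a) * h t" using chord[of a t b] assms that by simp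
      finally show ?thesis using d by simp
    qed
    then show "L t * indicator {a<..b} t \<le> h t * indicator {a<..b} t"
      by (auto simp: indicator_def)
  qed (rule integrable_indicator_unit[OF iL] integrable_indicator_unit[OF integrable_h], simp)+
  finally show ?thesis .
qed simp

text \<open>The triangle with vertices \<open>(0,0)\<close>, \<open>(x, h x)\<close>, \<open>(1,0)\<close> lies below the graph and has area \<open>h x / 2\<close>.\<close>
lemma h_le_2:
  assumes "0 \<le> x" "x \<le> 1" shows "h x \<le> 2"
proof -
  have "x * (h 0 + h x) / 2 \<le> H x" "(1 - x) * (h x + h 1) / 2 \<le> 1 - H x"
    using trapezoid[of 0 x] trapezoid[of x 1] assms by (simp_all add: H_0 H_1)
  moreover have "0 \<le> x * h 0" "0 \<le> (1 - x) * h 1" using assms h_nonneg by simp_all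
  ultimately show ?thesis by (simp add: field_simps)
qed

lemma h_pos:
  assumes "0 < x" "x < 1" shows "0 < h x"
proof -
  obtain y where y: "0 \<le> y" "y \<le> 1" "0 < h y"
    using weight h_nonneg unfolding weights1_def weights_def by (auto simp: less_le)
  show ?thesis
  proof (cases "x \<le> y")
    case True
    have "0 < x * h y" using assms y by simp
    also have "\<dots> \<le> y * h x" using chord_left[of x y] True assms y by simp
    finally show ?thesis using y by (simp add: zero_less_mult_iff)
  next
    case False
    have "0 < (1 - x) * h y" using assms y by simp
    also have "\<dots> \<le> (1 - y) * h x" using chord_right[of y x] False assms y by simp
    finally show ?thesis using y by (simp add: zero_less_mult_iff)
  qed
qed

lemma density_h: "density h"
  using continuous_h h_pos integral_h by (simp add: density_def)

lemma h_lower_bound: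
  assumes "0 \<le> x" "x \<le> 1" shows "h (1/2) * (x * (1 - x)) \<le> h x"
proof -
  have p: "0 < h (1/2)" by (rule h_pos) auto
  have 1: "h (1/2) * (x * (1 - x)) \<le> h (1/2) * x" "h (1/2) * (x * (1 - x)) \<le> h (1/2) * (1 - x)"
    using assms p by (auto intro!: mult_left_mono mult_left_le mult_left_le_one_le)
  show ?thesis
  proof (cases "x \<le> 1/2")
    case True
    have "0 \<le> h (1/2) * x" using assms p by simp
    then show ?thesis using chord_left[of x "1/2"] 1(1) assms True by (simp add: mult.commute)
  next
    case False
    have "0 \<le> h (1/2) * (1 - x)" using assms p by simp
    then show ?thesis using chord_right[of "1/2" x] 1(2) assms False by (simp add: mult.commute)
  qed
qed

lemma H_strict_mono:
  assumes "0 \<le> a" "a < b" "b \<le> 1" shows "H a < H b"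
proof (cases "a = 0 \<and> b = 1")
  case False
  then have "0 < h a \<or> 0 < h b" using assms h_pos by (cases "a = 0") auto
  then have "0 < h a + h b" using assms h_nonneg[of a] h_nonneg[of b] by auto
  then have "0 < (b - a) * (h a + h b) / 2" using assms by simp
  also have "\<dots> \<le> H b - H a" using trapezoid[of a b] assms by simp
  finally show ?thesis by simp
qed (simp add: H_0 H_1)

lemma H_less_iff:
  assumes "0 \<le> a" "a \<le> 1" "0 \<le> b" "b \<le> 1" shows "H a < H b \<longleftrightarrow> a < b"
  using H_strict_mono[of a b] H_strict_mono[of b a] assms by (cases a b rule: linorder_cases) auto

lemma H_bounds:
  assumes "0 < x" "x < 1" shows "0 < H x" "H x < 1"
  using H_strict_mono[of 0 x] H_strict_mono[of x 1] assms by (auto simp: H_0 H_1)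

lemma H_range:
  assumes "0 \<le> x" "x \<le> 1" shows "0 \<le> H x" "H x \<le> 1"
  using H_strict_mono[of 0 x] H_strict_mono[of x 1] assms
  by (cases "x = 0"; cases "x = 1"; auto simp: H_0 H_1)+

lemma H_image: "H ` {0<..<1} = {0<..<1}"
proof
  show "H ` {0<..<1} \<subseteq> {0<..<1}" using H_bounds by auto
  show "{0<..<1} \<subseteq> H ` {0<..<1}"
  proof
    fix y :: real assume y: "y \<in> {0<..<1}"
    then obtain x where x: "0 \<le> x" "x \<le> 1" "H x = y"
      using IVT'[of H 0 y 1] continuous_H by (auto simp: H_0 H_1)
    with y have "x \<noteq> 0" "x \<noteq> 1" by (auto simp: H_0 H_1)
    with x show "y \<in> H ` {0<..<1}" by force
  qed
qed

lemma H_inj: "inj_on H {0<..<1}"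
proof (rule linorder_inj_onI')
  fix i j :: real assume "i \<in> {0<..<1}" "j \<in> {0<..<1}" "i < j"
  then show "H i \<noteq> H j" using H_strict_mono[of i j] by auto
qed

end

text \<open>The case \<open>H x \<le> x\<close> of the inequality \<open>h_square_le\<close>, reduced to numbers: \<open>p\<close>, \<open>r\<close>, \<open>q\<close> are the values of the
  weight at \<open>0\<close>, \<open>H x\<close>, \<open>x\<close>; moreover \<open>y = x\<close> and \<open>s = H x\<close>. If \<open>p \<le> q\<close>, the chord is increasing and
  \<open>s\<close> may be lowered to the trapezoid area, where the chord has height at least \<open>q\<^sup>2/2 + p(2-p)/2\<close>;
  otherwise the chord is at least \<open>q\<close>, and \<open>q \<ge> q\<^sup>2/2\<close>.\<close>
lemma chord_arithmetic:
  fixes p q r s y :: real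
  assumes "0 < y" "0 \<le> s" "s \<le> y" "0 \<le> p" "p \<le> 2" "0 \<le> q" "q \<le> 2"
    and area: "y * (p + q) / 2 \<le> s" and ch: "(y - s) * p + s * q \<le> y * r"
  shows "q\<^sup>2 \<le> 2 * r"
proof (cases "p \<le> q")
  case True
  have "y * (p + (p + q) / 2 * (q - p)) = y * p + y * (p + q) / 2 * (q - p)"
    by (simp add: algebra_simps)
  also have "\<dots> \<le> y * p + s * (q - p)"
    using area True by (intro add_left_mono mult_right_mono) auto
  also have "\<dots> \<le> y * r" using ch by (simp add: algebra_simps)
  finally have "p + (p + q) / 2 * (q - p) \<le> r" using assms(1) by simp
  then have "2 * (p + (p + q) / 2 * (q - p)) \<le> 2 * r" by simp
  moreover have "2 * (p + (p + q) / 2 * (q - p)) = q\<^sup>2 + p * (2 - p)"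
    by (simp add: power2_eq_square field_simps)
  moreover have "q\<^sup>2 \<le> q\<^sup>2 + p * (2 - p)" using assms by simp
  ultimately show ?thesis by simp
next
  case False
  have "y * q \<le> (y - s) * p + s * q"
    using mult_left_mono[of q p "y - s"] False assms by (simp add: algebra_simps)
  then have "q \<le> r" using ch assms(1) by (meson mult_le_cancel_left_pos order_trans)
  moreover have "q\<^sup>2 \<le> 2 * q" using assms by (simp add: power2_eq_square mult_right_mono)
  ultimately show ?thesis by linarith
qed

context unit_weight begin

text \<open>The comparison of weights behind the upper bound. The case \<open>x \<le> H x\<close> is the case \<open>H x \<le> x\<close> for the
  reflected weight.\<close>
lemma h_square_le:
  assumes x: "0 \<le> x" "x \<le> 1" shows "(h x)\<^sup>2 \<le> 2 * h (H x)"
proof -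
  have edge: "q\<^sup>2 \<le> 2 * q" if "0 \<le> q" "q \<le> 2" for q :: real
    using that by (simp add: power2_eq_square mult_right_mono)
  have b: "0 \<le> h y" "h y \<le> 2" if "0 \<le> y" "y \<le> 1" for y
    using that h_nonneg h_le_2 by auto
  consider "x = 0" | "x = 1" | "0 < x" "x < 1" "H x \<le> x" | "0 < x" "x < 1" "x \<le> H x"
    using x by linarith
  then show ?thesis
  proof cases
    case 1 then show ?thesis using edge b[of 0] by (simp add: H_0)
  next
    case 2 then show ?thesis using edge b[of 1] by (simp add: H_1)
  next
    case 3
    show ?thesis
    proof (rule chord_arithmetic[of x "H x" "h 0"])
      show "x * (h 0 + h x) / 2 \<le> H x" using trapezoid[of 0 x] x by (simp add: H_0)
      show "(x - H x) * h 0 + H x * h x \<le> x * h (H x)"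
        using chord[of 0 "H x" x] 3 H_range[of x] by simp
    qed (use 3 b x H_range[of x] in auto)
  next
    case 4
    show ?thesis
    proof (rule chord_arithmetic[of "1 - x" "1 - H x" "h 1"])
      show "(1 - x) * (h 1 + h x) / 2 \<le> 1 - H x"
        using trapezoid[of x 1] x by (simp add: H_1 add.commute)
      show "(1 - x - (1 - H x)) * h 1 + (1 - H x) * h x \<le> (1 - x) * h (H x)"
        using chord[of x "H x" 1] 4 H_range[of x] by (simp add: algebra_simps)
    qed (use 4 b x H_range[of x] in auto)
  qed
qed

section \<open>Triangles and strictness of the comparison\<close>

text \<open>A weight of height \<open>2\<close> contains a triangle of full area \<open>1\<close>, which leaves no room for anything else:
  a value above the triangle would, with the trapezoids on both sides of it, give an area above \<open>1\<close>.\<close>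
lemma triangle_of_peak:
  assumes x0: "0 \<le> x\<^sub>0" "x\<^sub>0 \<le> 1" and peak: "h x\<^sub>0 = 2" and x: "0 \<le> x" "x \<le> 1"
  shows "h x = triangle_fun x\<^sub>0 x"
proof -
  have L: "x\<^sub>0 * h x = 2 * x" if "x \<le> x\<^sub>0"
  proof (rule antisym)
    show "2 * x \<le> x\<^sub>0 * h x"
      using chord_left[of x x\<^sub>0] that x x0 peak by simp
    have "x * (h 0 + h x) / 2 \<le> H x" "(x\<^sub>0 - x) * (h x + 2) / 2 \<le> H x\<^sub>0 - H x"
      "(1 - x\<^sub>0) * (2 + h 1) / 2 \<le> 1 - H x\<^sub>0"
      using trapezoid[of 0 x] trapezoid[of x x\<^sub>0] trapezoid[of x\<^sub>0 1] that x x0 peak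
      by (simp_all add: H_0 H_1)
    moreover have "0 \<le> x * h 0" "0 \<le> (1 - x\<^sub>0) * h 1" using x x0 h_nonneg by simp_all
    ultimately show "x\<^sub>0 * h x \<le> 2 * x" by (simp add: field_simps)
  qed
  have R: "(1 - x\<^sub>0) * h x = 2 * (1 - x)" if "x\<^sub>0 \<le> x"
  proof (rule antisym)
    show "2 * (1 - x) \<le> (1 - x\<^sub>0) * h x"
      using chord_right[of x\<^sub>0 x] that x x0 peak by simp
    have "x\<^sub>0 * (h 0 + 2) / 2 \<le> H x\<^sub>0" "(x - x\<^sub>0) * (2 + h x) / 2 \<le> H x - H x\<^sub>0"
      "(1 - x) * (h x + h 1) / 2 \<le> 1 - H x"
      using trapezoid[of 0 x\<^sub>0] trapezoid[of x\<^sub>0 x] trapezoid[of x 1] that x x0 peak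
      by (simp_all add: H_0 H_1)
    moreover have "0 \<le> (1 - x) * h 1" "0 \<le> x\<^sub>0 * h 0" using x x0 h_nonneg by simp_all
    ultimately show "(1 - x\<^sub>0) * h x \<le> 2 * (1 - x)" by (simp add: field_simps)
  qed
  show ?thesis
  proof (cases "x < x\<^sub>0")
    case True
    then show ?thesis using L x x0 by (auto simp: triangle_fun_def field_simps)
  next
    case False
    then show ?thesis using R L x x0 peak by (cases "x\<^sub>0 = 1") (auto simp: triangle_fun_def field_simps)
  qed
qed

text \<open>The trapezoids are exact on the two linear pieces; hence \<open>x\<^sub>0\<close> is a fixed point of \<open>H\<close>, each piece is mapped
  into itself, and \<open>H\<close> is explicit there.\<close>
lemma triangle_h_square:
  assumes x0: "0 \<le> x\<^sub>0" "x\<^sub>0 \<le> 1" and tri: "\<And>x. 0 \<le> x \<Longrightarrow> x \<le> 1 \<Longrightarrow> h x = triangle_fun x\<^sub>0 x"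
    and x: "0 < x" "x < 1"
  shows "(h x)\<^sup>2 = 2 * h (H x)"
proof -
  have L: "x\<^sub>0 * h y = 2 * y" if "0 \<le> y" "y \<le> x\<^sub>0" for y
    using that x0
    by (cases "y = x\<^sub>0") (auto simp: tri triangle_fun_def simp del: right_diff_distrib_numeral)
  have R: "(1 - x\<^sub>0) * h y = 2 * (1 - y)" if "y \<le> 1" "x\<^sub>0 \<le> y" for y
    using that x0 by (auto simp: tri triangle_fun_def)
  have peak: "h x\<^sub>0 = 2"
    using x0 by (auto simp: tri triangle_fun_def simp del: right_diff_distrib_numeral)
  have h0: "x\<^sub>0 * h 0 = 0" using L[of 0] x0 by simp
  have h1: "(1 - x\<^sub>0) * h 1 = 0" using R[of 1] x0 by simp
  have fix0: "H x\<^sub>0 = x\<^sub>0"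
  proof (rule antisym)
    have "x\<^sub>0 * (h 0 + 2) = 2 * x\<^sub>0" using h0 unfolding distrib_left by linarith
    moreover have "x\<^sub>0 * (h 0 + 2) / 2 \<le> H x\<^sub>0"
      using trapezoid[of 0 x\<^sub>0] x0 peak by (simp add: H_0)
    ultimately show "x\<^sub>0 \<le> H x\<^sub>0" by linarith
    have "(1 - x\<^sub>0) * (2 + h 1) = 2 * (1 - x\<^sub>0)" using h1 unfolding distrib_left by linarith
    moreover have "(1 - x\<^sub>0) * (2 + h 1) / 2 \<le> 1 - H x\<^sub>0"
      using trapezoid[of x\<^sub>0 1] x0 peak by (simp add: H_1)
    ultimately show "H x\<^sub>0 \<le> x\<^sub>0" by (simp only:) simp
  qed
  show ?thesis
  proof (cases "x \<le> x\<^sub>0")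
    case True
    then have p: "x\<^sub>0 > 0" using x by simp
    have h00: "h 0 = 0" using h0 p by simp
    have "x * h x / 2 \<le> H x" using trapezoid[of 0 x] x by (simp add: H_0 h00)
    moreover have "(x\<^sub>0 - x) * (h x + 2) / 2 \<le> x\<^sub>0 - H x"
      using trapezoid[of x x\<^sub>0] x x0 True peak fix0 by simp
    moreover have "(x\<^sub>0 - x) * (h x + 2) / 2 = x\<^sub>0 - x * h x / 2 + (x\<^sub>0 * h x / 2 - x)"
      by (simp add: field_simps)
    ultimately have Hx: "H x = x * h x / 2" using L[of x] x True by linarith
    have "H x \<le> x\<^sub>0" using H_less_iff[of x\<^sub>0 x] x x0 True fix0 by auto
    then have "x\<^sub>0 * h (H x) = 2 * H x" using L H_range[of x] x by simp
    then have "x\<^sub>0 * (2 * h (H x)) = 2 * x * h x" unfolding Hx by simp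
    also have "\<dots> = x\<^sub>0 * (h x)\<^sup>2" using L[of x] x True by (simp add: power2_eq_square)
    finally show ?thesis using p by simp
  next
    case False
    then have p: "1 - x\<^sub>0 > 0" using x by simp
    have h10: "h 1 = 0" using h1 p by simp
    have "(1 - x) * h x / 2 \<le> 1 - H x" using trapezoid[of x 1] x by (simp add: H_1 h10)
    moreover have "(x - x\<^sub>0) * (2 + h x) / 2 \<le> H x - x\<^sub>0"
      using trapezoid[of x\<^sub>0 x] x x0 False peak fix0 by simp
    moreover have "(x - x\<^sub>0) * (2 + h x) / 2 = (1 - x\<^sub>0) - (1 - x) * h x / 2"
    proof -
      have "(x - x\<^sub>0) * (2 + h x) = 2 * (1 - x\<^sub>0) - 2 * (1 - x) + (1 - x\<^sub>0) * h x - (1 - x) * h x"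
        by (simp add: algebra_simps)
      also have "(1 - x\<^sub>0) * h x = 2 * (1 - x)" using R[of x] x False by simp
      finally show ?thesis by simp
    qed
    ultimately have Hx: "1 - H x = (1 - x) * h x / 2" by linarith
    have "x\<^sub>0 \<le> H x" using H_less_iff[of x x\<^sub>0] x x0 False fix0 by auto
    then have "(1 - x\<^sub>0) * h (H x) = 2 * (1 - H x)" using R H_range[of x] x by simp
    then have "(1 - x\<^sub>0) * (2 * h (H x)) = 2 * (1 - x) * h x" unfolding Hx by (simp add: algebra_simps)
    also have "\<dots> = (1 - x\<^sub>0) * (h x)\<^sup>2" using R[of x] x False by (simp add: power2_eq_square)
    finally show ?thesis using p by simp
  qed
qed

text \<open>If the weight vanishes at both ends, it is at most \<open>1\<close> near them, so \<open>H x - x\<close> is non-positive near \<open>0\<close>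
  and non-negative near \<open>1\<close>. If it does not vanish at an end, that end is the fixed point.\<close>
lemma fixed_point:
  shows "\<exists>a\<in>{0..1}. H a = a \<and> 0 < h a"
proof (cases "h 0 = 0 \<and> h 1 = 0")
  case False
  then show ?thesis using H_0 H_1 h_nonneg[of 0] h_nonneg[of 1]
    by (auto intro: bexI[of _ 0] bexI[of _ 1] simp: less_le)
next
  case True
  have le: "H b - H a \<le> b - a" if "0 \<le> a" "a \<le> b" "b \<le> 1" "\<And>t. a \<le> t \<Longrightarrow> t \<le> b \<Longrightarrow> h t \<le> 1" for a b
  proof -
    have one: "integrable unit_measure (\<lambda>x. 1 :: real)" by simp
    have "H b - H a \<le> prim (\<lambda>x. 1) b - prim (\<lambda>x. 1) a"
      unfolding prim_diff[OF one that(2)] prim_diff[OF integrable_h that(2)]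
    proof (rule integral_unit_mono)
      fix t :: real
      show "h t * indicator {a<..b} t \<le> 1 * indicator {a<..b} t"
        using that(4) by (auto simp: indicator_def)
    qed (rule integrable_indicator_unit[OF one] integrable_indicator_unit[OF integrable_h], simp)+
    then show ?thesis using that by (simp add: prim_const)
  qed
  obtain d where d: "d > 0" "\<And>x. x \<in> {0..1} \<Longrightarrow> dist x 0 < d \<Longrightarrow> dist (h x) (h 0) < 1"
    using continuous_h unfolding continuous_on_iff by (metis atLeastAtMost_iff order.refl zero_le_one zero_less_one)
  obtain e where e: "e > 0" "\<And>x. x \<in> {0..1} \<Longrightarrow> dist x 1 < e \<Longrightarrow> dist (h x) (h 1) < 1"
    using continuous_h unfolding continuous_on_iff by (metis atLeastAtMost_iff order.refl zero_le_one zero_less_one)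
  define a where "a = min d (1/2) / 2"
  define b where "b = 1 - min e (1/2) / 2"
  have a: "0 < a" "a < d" "a \<le> 1/4" using d(1) by (auto simp: a_def min_def)
  have b: "b < 1" "1 - b < e" "3/4 \<le> b" using e(1) by (auto simp: b_def min_def)
  have "h t \<le> 1" if "0 \<le> t" "t \<le> a" for t
    using d(2)[of t] that a True by (simp add: dist_real_def abs_less_iff)
  then have "H a \<le> a" using le[of 0 a] a by (simp add: H_0)
  moreover have "h t \<le> 1" if "b \<le> t" "t \<le> 1" for t
    using e(2)[of t] that b True by (simp add: dist_real_def abs_less_iff)
  then have "b \<le> H b" using le[of b 1] b by (simp add: H_1)
  moreover have "continuous_on {a..b} (\<lambda>x. H x - x)"
    using a b by (intro continuous_intros continuous_on_subset[OF continuous_H]) auto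
  ultimately obtain x where "a \<le> x" "x \<le> b" "H x - x = 0"
    using IVT'[of "\<lambda>x. H x - x" a 0 b] a b by auto
  then show ?thesis using a b h_pos[of x] by (intro bexI[of _ x]) auto
qed

text \<open>At a fixed point \<open>a\<close> of \<open>H\<close> the difference is \<open>h a (2 - h a)\<close>, positive unless \<open>h a = 2\<close>; continuity does the rest.
  Strictness on a whole interval is all that can be hoped for, since equality holds near \<open>0\<close> for every
  weight that vanishes at \<open>0\<close> and is linear near it.\<close>
lemma h_square_less:
  assumes "\<And>x. 0 \<le> x \<Longrightarrow> x \<le> 1 \<Longrightarrow> h x \<noteq> 2"
  shows "\<exists>a b \<delta>. 0 < a \<and> a < b \<and> b < 1 \<and> 0 < \<delta> \<and>
    (\<forall>x\<in>{a..b}. \<delta> \<le> 2 * h (H x) - (h x)\<^sup>2)"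
proof -
  define k where "k x = 2 * h (H x) - (h x)\<^sup>2" for x
  have c: "continuous_on {0..1} k" unfolding k_def
    by (intro continuous_intros continuous_h continuous_on_compose2[OF continuous_h continuous_H])
       (use H_range in auto)
  obtain p where p: "0 \<le> p" "p \<le> 1" "H p = p" "0 < h p" using fixed_point by auto
  have "h p < 2" using assms[of p] h_le_2[of p] p by simp
  then have "0 < h p * (2 - h p)" using p by simp
  then have kp: "0 < k p" using p by (simp add: k_def power2_eq_square algebra_simps)
  then obtain d where d: "d > 0" "\<And>x. x \<in> {0..1} \<Longrightarrow> dist x p < d \<Longrightarrow> dist (k x) (k p) < k p / 2"
    using c p unfolding continuous_on_iff by (metis atLeastAtMost_iff half_gt_zero)
  have low: "k p / 2 \<le> k x" if "0 \<le> x" "x \<le> 1" "\<bar>x - p\<bar> < d" for x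
  proof -
    have "\<bar>k x - k p\<bar> < k p / 2" using d(2)[of x] that by (simp add: dist_real_def)
    then show ?thesis by linarith
  qed
  define e where "e = min d (1/2)"
  have e: "0 < e" "e \<le> d" "e \<le> 1/2" using d(1) by (auto simp: e_def)
  show ?thesis
  proof (cases "p \<le> 1/2")
    case True
    then show ?thesis using low e p kp unfolding k_def[symmetric]
      by (intro exI[of _ "p + e/3"] exI[of _ "p + e/2"] exI[of _ "k p / 2"]) auto
  next
    case False
    then show ?thesis using low e p kp unfolding k_def[symmetric]
      by (intro exI[of _ "p - e/2"] exI[of _ "p - e/3"] exI[of _ "k p / 2"]) auto
  qed
qed

end

section \<open>The change of variables and the upper bound\<close>

lemma integral_unit_substitution:
  fixes g g' f :: "real \<Rightarrow> real"
  assumes d: "\<And>x. 0 < x \<Longrightarrow> x < 1 \<Longrightarrow> (g has_real_derivative g' x) (at x)"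
    and inj: "inj_on g {0<..<1}" and im: "g ` {0<..<1} = {0<..<1}"
  shows "integrable unit_measure (\<lambda>x. f (g x) * \<bar>g' x\<bar>) \<longleftrightarrow> integrable unit_measure f"
    and "(\<integral>x. f (g x) * \<bar>g' x\<bar> \<partial>unit_measure) = (\<integral>x. f x \<partial>unit_measure)"
proof -
  have S: "{0<..<1::real} \<in> sets lebesgue" by simp
  have ai: "F absolutely_integrable_on {0<..<1} \<longleftrightarrow> integrable unit_measure F" for F :: "real \<Rightarrow> real"
    by (rule set_integrable_eq) simp
  have *: "((\<lambda>x. \<bar>g' x\<bar> * f (g x)) absolutely_integrable_on {0<..<1} \<and>
      integral {0<..<1} (\<lambda>x. \<bar>g' x\<bar> * f (g x)) = b) \<longleftrightarrow>
      (f absolutely_integrable_on {0<..<1} \<and> integral {0<..<1} f = b)" for b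
    using has_absolute_integral_change_of_variables_1'[OF S _ inj, of g' f b] d
    unfolding im by (auto intro: has_field_derivative_at_within)
  have *: "(integrable unit_measure (\<lambda>x. f (g x) * \<bar>g' x\<bar>) \<and>
      integral {0<..<1} (\<lambda>x. f (g x) * \<bar>g' x\<bar>) = b) \<longleftrightarrow>
      (integrable unit_measure f \<and> integral {0<..<1} f = b)" for b
    using *[of b] unfolding ai by (simp add: mult.commute)
  show iff: "integrable unit_measure (\<lambda>x. f (g x) * \<bar>g' x\<bar>) \<longleftrightarrow> integrable unit_measure f"
    using * by blast
  show "(\<integral>x. f (g x) * \<bar>g' x\<bar> \<partial>unit_measure) = (\<integral>x. f x \<partial>unit_measure)"
  proof (cases "integrable unit_measure f")
    case True
    then show ?thesis using * iff by (simp add: lebesgue_integral_eq_integral)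
  next
    case False
    then show ?thesis using iff by (simp add: not_integrable_integral_eq)
  qed
qed

lemma reflect_unit:
  fixes f :: "real \<Rightarrow> real"
  shows "integrable unit_measure (\<lambda>x. f (1 - x)) \<longleftrightarrow> integrable unit_measure f"
    and "(\<integral>x. f (1 - x) \<partial>unit_measure) = (\<integral>x. f x \<partial>unit_measure)"
proof -
  have d: "((\<lambda>x. 1 - x) has_real_derivative -1) (at x)" for x :: real
    by (auto intro!: derivative_eq_intros)
  have inj: "inj_on (\<lambda>x. 1 - x) {0<..<1::real}" by (simp add: inj_on_def)
  have im: "(\<lambda>x. 1 - x) ` {0<..<1} = {0<..<1::real}"
    by (auto simp: image_iff intro!: bexI[of _ "1 - x" for x])
  show "integrable unit_measure (\<lambda>x. f (1 - x)) \<longleftrightarrow> integrable unit_measure f"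
    "(\<integral>x. f (1 - x) \<partial>unit_measure) = (\<integral>x. f x \<partial>unit_measure)"
    using integral_unit_substitution[OF d inj im, of f] by simp_all
qed

context unit_weight begin

lemma H_substitution:
  shows "integrable unit_measure (\<lambda>x. f (H x) * h x) \<longleftrightarrow> integrable unit_measure f"
    and "(\<integral>x. f (H x) * h x \<partial>unit_measure) = (\<integral>x. f x \<partial>unit_measure)"
proof -
  note sub = integral_unit_substitution[OF prim_has_derivative[OF continuous_h] H_inj H_image, of f]
  have eq: "f (H x) * \<bar>h x\<bar> = f (H x) * h x" if "0 < x" "x < 1" for x
    using h_nonneg[of x] that by simp
  show "integrable unit_measure (\<lambda>x. f (H x) * h x) \<longleftrightarrow> integrable unit_measure f"
    using sub(1) integrable_unit_cong[OF eq] by simp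
  show "(\<integral>x. f (H x) * h x \<partial>unit_measure) = (\<integral>x. f x \<partial>unit_measure)"
    using sub(2) integral_unit_cong[OF eq] by simp
qed

text \<open>The derivative of \<open>v \<circ> H\<close> when \<open>f\<close> is the derivative of \<open>v\<close>.\<close>
definition pullback :: "(real \<Rightarrow> real) \<Rightarrow> real \<Rightarrow> real" where
  "pullback f x = f (H x) * h x"

lemma prim_pullback:
  assumes "0 < x" "x < 1"
  shows "prim (pullback f) x = prim f (H x)"
proof -
  have "prim (pullback f) x = (\<integral>t. pullback f t * indicator {..x} t \<partial>unit_measure)"
    by (rule prim_def)
  also have "\<dots> = (\<integral>t. (f (H t) * indicator {..H x} (H t)) * h t \<partial>unit_measure)"
    unfolding pullback_def
  proof (rule integral_unit_cong)
    fix t :: real assume "0 < t" "t < 1"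
    then have "indicator {..H x} (H t) = (indicator {..x} t :: real)"
      using H_less_iff[of x t] assms by (auto simp: indicator_def not_less[symmetric])
    then show "f (H t) * h t * indicator {..x} t = f (H t) * indicator {..H x} (H t) * h t"
      by simp
  qed
  also have "\<dots> = prim f (H x)"
    unfolding prim_def[of f "H x"] by (rule H_substitution(2))
  finally show ?thesis .
qed

lemma variance_pullback: "variance h (pullback f) = variance (\<lambda>x. 1) f"
proof -
  have "(\<integral>x. (prim (pullback f) x)\<^sup>2 * h x \<partial>unit_measure) = (\<integral>x. (prim f (H x))\<^sup>2 * h x \<partial>unit_measure)"
    "(\<integral>x. prim (pullback f) x * h x \<partial>unit_measure) = (\<integral>x. prim f (H x) * h x \<partial>unit_measure)"
    by (auto intro!: integral_unit_cong simp: prim_pullback)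
  then show ?thesis
    unfolding variance_def using H_substitution(2)[of "\<lambda>s. (prim f s)\<^sup>2"] H_substitution(2)[of "prim f"]
    by simp
qed

lemma continuous_h_H: "continuous_on {0..1} (\<lambda>x. h (H x))"
  by (rule continuous_on_compose2[OF continuous_h continuous_H]) (use H_range in auto)

lemma square_integrable_pullback:
  assumes f: "square_integrable f" shows "square_integrable (pullback f)"
proof -
  have "integrable unit_measure (\<lambda>x. (f (H x))\<^sup>2 * h x)"
    using square_integrable_square[OF f] H_substitution(1)[of "\<lambda>s. (f s)\<^sup>2"] by simp
  then have "integrable unit_measure (\<lambda>x. (f (H x))\<^sup>2 * h x * h x)"
    by (rule integrable_times_continuous[OF _ continuous_h])
  then have "integrable unit_measure (\<lambda>x. (pullback f x)\<^sup>2)"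
    by (simp add: pullback_def power2_eq_square mult_ac)
  moreover have "integrable unit_measure (pullback f)"
    using H_substitution(1)[of f] square_integrable_integrable[OF f] by (simp add: pullback_def[abs_def])
  ultimately show ?thesis by (simp add: square_integrable_def)
qed

text \<open>The substitution \<open>s = H x\<close> brings both energies to the variable \<open>x\<close>, where the difference of the weights
  is the defect in \<open>h_square_le\<close>.\<close>
lemma energy_pullback_eq:
  assumes f: "square_integrable f"
  shows "2 * energy h f - energy h (pullback f)
    = (\<integral>x. (f (H x))\<^sup>2 * h x * (2 * h (H x) - (h x)\<^sup>2) \<partial>unit_measure)"
proof -
  have i: "integrable unit_measure (\<lambda>x. (f (H x))\<^sup>2 * h x)"
    using f H_substitution(1)[of "\<lambda>s. (f s)\<^sup>2"] by (simp add: square_integrable_def)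
  have i1: "integrable unit_measure (\<lambda>x. (f (H x))\<^sup>2 * h x * h (H x))"
    by (rule integrable_times_continuous[OF i continuous_h_H])
  have i2: "integrable unit_measure (\<lambda>x. (f (H x))\<^sup>2 * h x * (h x)\<^sup>2)"
    by (intro integrable_times_continuous[OF i] continuous_intros continuous_h)
  have e1: "energy h f = (\<integral>x. (f (H x))\<^sup>2 * h x * h (H x) \<partial>unit_measure)"
    unfolding energy_def using H_substitution(2)[of "\<lambda>s. (f s)\<^sup>2 * h s"] by (simp add: mult_ac)
  have e2: "energy h (pullback f) = (\<integral>x. (f (H x))\<^sup>2 * h x * (h x)\<^sup>2 \<partial>unit_measure)"
    unfolding energy_def pullback_def by (simp add: power2_eq_square mult_ac)
  have "(\<integral>x. (f (H x))\<^sup>2 * h x * (2 * h (H x) - (h x)\<^sup>2) \<partial>unit_measure)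
      = (\<integral>x. 2 * ((f (H x))\<^sup>2 * h x * h (H x)) - (f (H x))\<^sup>2 * h x * (h x)\<^sup>2 \<partial>unit_measure)"
    by (rule integral_unit_cong) (simp add: algebra_simps)
  also have "\<dots> = 2 * energy h f - energy h (pullback f)" unfolding e1 e2 using i1 i2 by simp
  finally show ?thesis ..
qed

lemma energy_pullback_le:
  assumes f: "square_integrable f"
  shows "energy h (pullback f) \<le> 2 * energy h f"
proof -
  have "0 \<le> 2 * energy h f - energy h (pullback f)"
    unfolding energy_pullback_eq[OF f] using h_square_le h_nonneg
    by (intro integral_unit_nonneg mult_nonneg_nonneg) auto
  then show ?thesis by simp
qed

lemma h_nonneg_interior: "0 < x \<Longrightarrow> x < 1 \<Longrightarrow> 0 \<le> h x"
  using h_nonneg by simp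

lemma mu_le_energy_pullback:
  assumes f: "square_integrable f"
  shows "spectral_gap h h * variance (\<lambda>x. 1) f \<le> energy h (pullback f)"
  using spectral_gap_le[OF density_h h_nonneg_interior square_integrable_pullback[OF f]]
  by (simp add: variance_pullback)

lemma mu_le_2_sigma: "spectral_gap h h \<le> 2 * spectral_gap h (\<lambda>x. 1)"
proof -
  have "spectral_gap h h / 2 \<le> spectral_gap h (\<lambda>x. 1)"
  proof (rule le_spectral_gap[OF density_1])
    fix f assume "square_integrable f"
    then have "spectral_gap h h * variance (\<lambda>x. 1) f \<le> 2 * energy h f"
      using mu_le_energy_pullback energy_pullback_le by (meson order_trans)
    then show "spectral_gap h h / 2 * variance (\<lambda>x. 1) f \<le> energy h f" by simp
  qed
  then show ?thesis by simp
qed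

text \<open>The weight is bounded from below by a multiple of \<open>x(1-x)\<close>, and so the bound on the moment gives
  \<open>moment\<^sup>2 \<le> 2 S h / c\<close> for the variance \<open>S\<close>. Young's inequality for the product of \<open>f\<close> and its moment
  absorbs half of the variance.\<close>
lemma sigma_pos: "0 < spectral_gap h (\<lambda>x. 1)"
proof -
  define c where "c = h (1/2)"
  have c: "c > 0" unfolding c_def by (rule h_pos) auto
  have "c / 2 \<le> spectral_gap h (\<lambda>x. 1)"
  proof (rule le_spectral_gap[OF density_1])
    fix f assume f: "square_integrable f"
    let ?S = "variance (\<lambda>x. 1) f"
    have fi: "integrable unit_measure f" using f by (rule square_integrable_integrable)
    have "?S = (\<integral>x. f x * moment f x \<partial>unit_measure)" by (rule variance_moment[OF fi])
    also have "\<dots> \<le> (\<integral>x. (f x)\<^sup>2 * h x / c + ?S / 2 \<partial>unit_measure)"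
    proof (rule integral_unit_mono)
      show "integrable unit_measure (\<lambda>x. f x * moment f x)"
        by (rule integrable_times_continuous[OF fi continuous_moment[OF fi]])
      show "integrable unit_measure (\<lambda>x. (f x)\<^sup>2 * h x / c + ?S / 2)"
        using energy_integrable[OF f continuous_h] by simp
      fix x :: real assume x: "0 < x" "x < 1"
      have hx: "h x > 0" using h_pos x by simp
      have "(moment f x)\<^sup>2 * c \<le> 2 * (x * (1 - x)) * ?S * c"
        using moment_bound[OF fi, of x] x c by (intro mult_right_mono) auto
      also have "\<dots> = 2 * ?S * (c * (x * (1 - x)))" by simp
      also have "\<dots> \<le> 2 * ?S * h x"
        using h_lower_bound[of x] x variance_nonneg[OF density_1 fi]
        unfolding c_def by (intro mult_left_mono) auto
      finally have "(moment f x)\<^sup>2 * c \<le> 2 * ?S * h x" .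
      moreover define A E where "A = (f x)\<^sup>2 * h x / c" and "E = (moment f x)\<^sup>2 * c / h x"
      ultimately have m: "E \<le> 2 * ?S" using hx by (simp add: pos_divide_le_eq)
      have "0 \<le> (f x * h x * 2 / c - moment f x)\<^sup>2 * (c / (4 * h x))"
        using c hx by simp
      also have "\<dots> = A - f x * moment f x + E / 4"
        using c hx by (simp add: A_def E_def power2_eq_square field_simps)
      finally show "f x * moment f x \<le> (f x)\<^sup>2 * h x / c + ?S / 2"
        using m unfolding A_def[symmetric] by linarith
    qed
    also have "\<dots> = energy h f / c + ?S / 2"
      using energy_integrable[OF f continuous_h] by (simp add: energy_def)
    finally have "?S / 2 \<le> energy h f / c" by linarith
    then show "c / 2 * ?S \<le> energy h f" using c by (simp add: pos_le_divide_eq mult_ac)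
  qed
  then show ?thesis using c by simp
qed

section \<open>Equality for triangles\<close>

lemma energy_pullback_triangle:
  assumes "square_integrable f" and "\<And>x. 0 < x \<Longrightarrow> x < 1 \<Longrightarrow> (h x)\<^sup>2 = 2 * h (H x)"
  shows "energy h (pullback f) = 2 * energy h f"
proof -
  have "2 * energy h f - energy h (pullback f) = (\<integral>x. 0 \<partial>unit_measure)"
    unfolding energy_pullback_eq[OF assms(1)] using assms(2) by (intro integral_unit_cong) simp
  then show ?thesis by simp
qed

text \<open>The bound on \<open>F\<close> makes \<open>F/h\<close> bounded. This is needed because the inverse of the change of variables
  may leave \<open>H\<^sup>1\<close> when \<open>h\<close> vanishes at an end of the interval.\<close>
lemma pullback_surj:
  assumes F: "square_integrable F" and bound: "\<And>x. 0 < x \<Longrightarrow> x < 1 \<Longrightarrow> \<bar>F x\<bar> \<le> C * h x"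
  obtains f where "square_integrable f" "\<And>x. 0 < x \<Longrightarrow> x < 1 \<Longrightarrow> pullback f x = F x"
proof
  define f where "f s = (let x = the_inv_into {0<..<1} H s in F x / h x)" for s
  have fH: "f (H x) = F x / h x" if "0 < x" "x < 1" for x
    using that by (simp add: f_def the_inv_into_f_f[OF H_inj])
  show p: "pullback f x = F x" if "0 < x" "x < 1" for x
    using fH[OF that] h_pos[OF that] by (simp add: pullback_def)
  have "integrable unit_measure f"
    using H_substitution(1)[of f] integrable_unit_cong[of "\<lambda>x. f (H x) * h x" F] p
      square_integrable_integrable[OF F] by (simp add: pullback_def)
  moreover have "integrable unit_measure (\<lambda>s. (f s)\<^sup>2)"
  proof -
    have hm: "h \<in> borel_measurable unit_measure" "F \<in> borel_measurable unit_measure"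
      using continuous_measurable_unit[OF continuous_h] square_integrable_measurable[OF F] .
    have "integrable unit_measure (\<lambda>x. F x * (F x / h x))"
    proof (rule integrable_times_bounded[OF square_integrable_integrable[OF F]])
      show "(\<lambda>x. F x / h x) \<in> borel_measurable unit_measure"
        using hm by (intro borel_measurable_divide)
      fix x :: real assume x: "0 < x" "x < 1"
      then show "\<bar>F x / h x\<bar> \<le> C"
        using bound[OF x] h_pos[OF x] by (simp add: pos_divide_le_eq)
    qed
    moreover have "F x * (F x / h x) = (f (H x))\<^sup>2 * h x" if "0 < x" "x < 1" for x
      using fH[OF that] h_pos[OF that] by (simp add: power2_eq_square)
    ultimately have "integrable unit_measure (\<lambda>x. (f (H x))\<^sup>2 * h x)"
      using integrable_unit_cong[of "\<lambda>x. F x * (F x / h x)" "\<lambda>x. (f (H x))\<^sup>2 * h x"] by simp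
    then show ?thesis using H_substitution(1)[of "\<lambda>s. (f s)\<^sup>2"] by simp
  qed
  ultimately show "square_integrable f" by (simp add: square_integrable_def)
qed

lemma variance_cong:
  assumes "\<And>x. 0 < x \<Longrightarrow> x < 1 \<Longrightarrow> f x = g x"
  shows "variance k f = variance k g"
  unfolding variance_def using prim_cong[of f g, OF assms] by simp

lemma energy_cong:
  assumes "\<And>x. 0 < x \<Longrightarrow> x < 1 \<Longrightarrow> f x = g x"
  shows "energy k f = energy k g"
  unfolding energy_def using assms by (intro integral_unit_cong) simp

text \<open>When \<open>h\<^sup>2 = 2 h \<circ> H\<close> the change of variables doubles the energy exactly, and it can be inverted on
  derivatives \<open>F\<close> with \<open>\<bar>F\<bar> \<le> n h\<close>. A general derivative is cut off to satisfy this bound; the energy does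
  not increase, and the variance converges as \<open>n\<close> tends to infinity.\<close>
lemma two_sigma_le_mu:
  assumes sq: "\<And>x. 0 < x \<Longrightarrow> x < 1 \<Longrightarrow> (h x)\<^sup>2 = 2 * h (H x)"
  shows "2 * spectral_gap h (\<lambda>x. 1) \<le> spectral_gap h h"
proof (rule le_spectral_gap[OF density_h])
  let ?\<sigma> = "spectral_gap h (\<lambda>x. 1)"
  fix F assume F: "square_integrable F"
  have Fi: "integrable unit_measure F" using F by (rule square_integrable_integrable)
  have meas: "h \<in> borel_measurable unit_measure" "F \<in> borel_measurable unit_measure"
    using continuous_measurable_unit[OF continuous_h] square_integrable_measurable[OF F] .
  define A where "A n x = (if \<bar>F x\<bar> \<le> real n * h x then 1 else 0 :: real)" for n x
  have Am: "A n \<in> borel_measurable unit_measure" for n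
  proof -
    have "Measurable.pred unit_measure (\<lambda>x. \<bar>F x\<bar> \<le> real n * h x)"
      unfolding pred_def using meas
      by (intro borel_measurable_le borel_measurable_abs borel_measurable_times) auto
    then show ?thesis unfolding A_def[abs_def] by measurable
  qed
  have Ab: "\<bar>A n x\<bar> \<le> 1" for n x by (simp add: A_def)
  define G where "G n x = F x * A n x" for n x
  have G: "square_integrable (G n)" for n
    unfolding G_def[abs_def] using F Am Ab by (rule square_integrable_times_bounded)
  have Gle: "2 * ?\<sigma> * variance h (G n) \<le> energy h F" for n
  proof -
    have "\<bar>G n x\<bar> \<le> real n * h x" if "0 < x" "x < 1" for x
      using h_pos[OF that] by (auto simp: G_def A_def)
    then obtain f where f: "square_integrable f" "\<And>x. 0 < x \<Longrightarrow> x < 1 \<Longrightarrow> pullback f x = G n x"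
      using pullback_surj[OF G] by metis
    have "?\<sigma> * variance (\<lambda>x. 1) f \<le> energy h f"
      by (rule spectral_gap_le[OF density_1 h_nonneg_interior f(1)])
    then have "2 * ?\<sigma> * variance h (G n) \<le> energy h (G n)"
      using variance_pullback[of f] energy_pullback_triangle[OF f(1) sq]
        variance_cong[OF f(2)] energy_cong[OF f(2)] by simp
    also have "\<dots> \<le> energy h F"
      unfolding energy_def
    proof (rule integral_unit_mono)
      fix x :: real assume "0 < x" "x < 1"
      then show "(G n x)\<^sup>2 * h x \<le> (F x)\<^sup>2 * h x"
        using h_nonneg[of x] by (auto simp: G_def A_def)
    qed (intro energy_integrable G F continuous_h)+
    finally show ?thesis .
  qed
  have lim: "(\<lambda>n. prim (G n) x) \<longlonglongrightarrow> prim F x" for x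
    unfolding prim_def
  proof (rule integral_dominated_convergence[where w = "\<lambda>t. \<bar>F t\<bar>"])
    show "AE t in unit_measure. (\<lambda>n. G n t * indicator {..x} t) \<longlonglongrightarrow> F t * indicator {..x} t"
    proof (rule AE_I2)
      fix t assume "t \<in> space unit_measure"
      then have t: "h t > 0" using h_pos[of t] by auto
      have "\<forall>\<^sub>F n in sequentially. G n t = F t"
        using eventually_ge_at_top[of "nat \<lceil>\<bar>F t\<bar> / h t\<rceil>"]
      proof eventually_elim
        fix n assume "nat \<lceil>\<bar>F t\<bar> / h t\<rceil> \<le> n"
        then have "\<bar>F t\<bar> / h t \<le> real n" by linarith
        then show "G n t = F t" using t by (simp add: G_def A_def pos_divide_le_eq)
      qed
      then show "(\<lambda>n. G n t * indicator {..x} t) \<longlonglongrightarrow> F t * indicator {..x} t"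
        by (intro tendsto_mult tendsto_const tendsto_eventually)
    qed
    show "AE t in unit_measure. norm (G n t * indicator {..x} t) \<le> \<bar>F t\<bar>" for n
      by (auto simp: G_def A_def indicator_def)
    show "(\<lambda>t. G n t * indicator {..x} t) \<in> borel_measurable unit_measure" for n
      using integrable_indicator_unit[OF square_integrable_integrable[OF G]]
      by (intro borel_measurable_integrable) auto
    show "(\<lambda>t. F t * indicator {..x} t) \<in> borel_measurable unit_measure"
      using integrable_indicator_unit[OF Fi] by (intro borel_measurable_integrable) auto
  qed (use Fi in auto)
  define B where "B = (\<integral>t. \<bar>F t\<bar> \<partial>unit_measure)"
  have bd: "\<bar>prim (G n) x\<bar> \<le> B" for n x
  proof -
    have "\<bar>prim (G n) x\<bar> \<le> (\<integral>t. \<bar>G n t * indicator {..x} t\<bar> \<partial>unit_measure)"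
      unfolding prim_def by (rule integral_abs_bound)
    also have "\<dots> \<le> B" unfolding B_def
    proof (rule integral_unit_mono)
      show "\<bar>G n t * indicator {..x} t\<bar> \<le> \<bar>F t\<bar>" for t
        by (auto simp: G_def A_def indicator_def)
    qed (use Fi integrable_indicator_unit[OF square_integrable_integrable[OF G]] in auto)
    finally show ?thesis .
  qed
  have cp: "continuous_on {0..1} (prim (G n))" "continuous_on {0..1} (prim F)" for n
    using continuous_prim square_integrable_integrable G F by auto
  have "(\<lambda>n. variance h (G n)) \<longlonglongrightarrow> variance h F"
    unfolding variance_def
  proof (intro tendsto_diff tendsto_power)
    show "(\<lambda>n. \<integral>x. (prim (G n) x)\<^sup>2 * h x \<partial>unit_measure) \<longlonglongrightarrow> (\<integral>x. (prim F x)\<^sup>2 * h x \<partial>unit_measure)"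
    proof (rule integral_dominated_convergence[where w = "\<lambda>x. B\<^sup>2 * h x"])
      show "AE x in unit_measure. norm ((prim (G n) x)\<^sup>2 * h x) \<le> B\<^sup>2 * h x" for n
      proof (rule AE_I2)
        fix x assume "x \<in> space unit_measure"
        moreover have "(prim (G n) x)\<^sup>2 \<le> B\<^sup>2" using bd[of n x] abs_le_square_iff[of "prim (G n) x" B] by simp
        ultimately show "norm ((prim (G n) x)\<^sup>2 * h x) \<le> B\<^sup>2 * h x"
          using h_nonneg[of x] by (auto simp: abs_mult intro!: mult_right_mono)
      qed
      show "(\<lambda>x. (prim (G n) x)\<^sup>2 * h x) \<in> borel_measurable unit_measure" for n
        by (intro continuous_measurable_unit continuous_intros cp continuous_h)
      show "(\<lambda>x. (prim F x)\<^sup>2 * h x) \<in> borel_measurable unit_measure"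
        by (intro continuous_measurable_unit continuous_intros cp continuous_h)
      show "AE x in unit_measure. (\<lambda>n. (prim (G n) x)\<^sup>2 * h x) \<longlonglongrightarrow> (prim F x)\<^sup>2 * h x"
        by (intro AE_I2 tendsto_intros lim)
    qed (use integrable_h in simp)
    show "(\<lambda>n. \<integral>x. prim (G n) x * h x \<partial>unit_measure) \<longlonglongrightarrow> (\<integral>x. prim F x * h x \<partial>unit_measure)"
    proof (rule integral_dominated_convergence[where w = "\<lambda>x. B * h x"])
      show "AE x in unit_measure. norm (prim (G n) x * h x) \<le> B * h x" for n
        using bd[of n] h_nonneg by (auto simp: abs_mult intro!: mult_right_mono AE_I2)
      show "(\<lambda>x. prim (G n) x * h x) \<in> borel_measurable unit_measure" for n
        by (intro continuous_measurable_unit continuous_intros cp continuous_h)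
      show "(\<lambda>x. prim F x * h x) \<in> borel_measurable unit_measure"
        by (intro continuous_measurable_unit continuous_intros cp continuous_h)
      show "AE x in unit_measure. (\<lambda>n. prim (G n) x * h x) \<longlonglongrightarrow> prim F x * h x"
        by (intro AE_I2 tendsto_intros lim)
    qed (use integrable_h in simp)
  qed
  then have "(\<lambda>n. 2 * ?\<sigma> * variance h (G n)) \<longlonglongrightarrow> 2 * ?\<sigma> * variance h F"
    by (intro tendsto_intros)
  then show "2 * ?\<sigma> * variance h F \<le> energy h F"
    by (rule LIMSEQ_le_const2) (use Gle in auto)
qed

section \<open>Strict inequality for all other weights\<close>

lemma spectral_gap_sigma_le:
  assumes "square_integrable f"
  shows "spectral_gap h (\<lambda>x. 1) * variance (\<lambda>x. 1) f \<le> energy h f"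
  by (rule spectral_gap_le[OF density_1 h_nonneg_interior assms])

text \<open>Suppose that the moment is small on \<open>{a<..b}\<close>. By \<open>moment_chord\<close> it is then at most some small \<open>M\<close> everywhere.
  The variance is the integral of \<open>f\<close> times its moment, at most \<open>N0/2\<close> times the integral of
  \<open>moment\<^sup>2/h\<close> plus \<open>energy/(2 N0)\<close>. The quotient \<open>moment\<^sup>2/h\<close> is at most \<open>2/c\<close> everywhere, which is harmless
  within distance \<open>\<epsilon>\<close> of the ends, and at most \<open>M\<^sup>2/D\<close> elsewhere. So the variance stays below \<open>1\<close>.\<close>
lemma moment_integral_lower_bound:
  assumes ab: "0 < a" "a < b" "b < 1" and N0: "N0 > 0"
  shows "\<exists>q>0. \<forall>f. square_integrable f \<longrightarrow> (\<forall>x. 0 < x \<longrightarrow> x < 1 \<longrightarrow> 0 \<le> f x) \<longrightarrow>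
    variance (\<lambda>x. 1) f = 1 \<longrightarrow> energy h f \<le> N0 \<longrightarrow>
    q \<le> (\<integral>x. indicator {a<..b} x * moment f x \<partial>unit_measure)"
proof -
  define c where "c = h (1/2)"
  have c: "c > 0" unfolding c_def by (rule h_pos) auto
  \<comment> \<open>\<open>\<epsilon>\<close> and \<open>M\<close> are chosen such that the three contributions to the variance add up to
    \<open>1/2 + 1/8 + 1/4\<close>\<close>
  define \<epsilon> where "\<epsilon> = min (1/4) (c / (16 * N0))"
  have \<epsilon>: "0 < \<epsilon>" "\<epsilon> \<le> 1/4" "\<epsilon> \<le> c / (16 * N0)" using c N0 by (auto simp: \<epsilon>_def)
  define \<kappa> where "\<kappa> = (b - a) * (a * (1 - b))"
  have \<kappa>: "\<kappa> > 0" using ab by (simp add: \<kappa>_def)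
  define D where "D = c * (\<epsilon> * (1 - \<epsilon>))"
  have D: "D > 0" using c \<epsilon> by (simp add: D_def)
  define M where "M = sqrt (D / (2 * N0))"
  have M: "M > 0" "M\<^sup>2 = D / (2 * N0)" using D N0 by (simp_all add: M_def)
  have "\<kappa> * M \<le> (\<integral>x. indicator {a<..b} x * moment f x \<partial>unit_measure)"
    if f: "square_integrable f" and pos: "\<And>x. 0 < x \<Longrightarrow> x < 1 \<Longrightarrow> 0 \<le> f x"
      and var: "variance (\<lambda>x. 1) f = 1" and en: "energy h f \<le> N0" for f
  proof (rule ccontr)
    define q where "q = (\<integral>x. indicator {a<..b} x * moment f x \<partial>unit_measure)"
    assume "\<not> ?thesis"
    then have qM: "q < \<kappa> * M" by (simp add: q_def)
    have fi: "integrable unit_measure f" using f by (rule square_integrable_integrable)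
    have mi: "integrable unit_measure (moment f)"
      by (rule integrable_continuous_unit[OF continuous_moment[OF fi]])
    have ind: "(\<integral>x. c * indicator {u<..v} x \<partial>unit_measure) = c * (v - u)"
      if "0 \<le> u" "u \<le> v" "v \<le> 1" for u v c :: real
      using prim_diff[of "\<lambda>x. c" u v] that by (simp add: prim_const algebra_simps)
    have ci: "integrable unit_measure (\<lambda>x. c)" for c :: real by simp
    have m0: "0 \<le> moment f z" if "0 \<le> z" "z \<le> 1" for z
    proof -
      have "z * (1 - z) * moment f 0 \<le> moment f z" using moment_chord[OF fi pos, of z 0] that by simp
      then show ?thesis by (simp add: moment_def prim_0)
    qed
    have mM: "moment f z \<le> M" if z: "0 \<le> z" "z \<le> 1" for z
    proof -
      have "\<kappa> * moment f z = (\<integral>x. a * (1 - b) * moment f z * indicator {a<..b} x \<partial>unit_measure)"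
        unfolding \<kappa>_def by (subst ind) (use ab in \<open>simp_all add: mult_ac\<close>)
      also have "\<dots> \<le> (\<integral>x. moment f x * indicator {a<..b} x \<partial>unit_measure)"
      proof (rule integral_unit_mono)
        fix x :: real assume x: "0 < x" "x < 1"
        show "a * (1 - b) * moment f z * indicator {a<..b} x \<le> moment f x * indicator {a<..b} x"
        proof (cases "x \<in> {a<..b}")
          case True
          then have "a * (1 - b) \<le> x * (1 - x)" using ab x by (intro mult_mono) auto
          then have "a * (1 - b) * moment f z \<le> x * (1 - x) * moment f z"
            using m0[OF z] by (rule mult_right_mono)
          also have "\<dots> \<le> moment f x" using moment_chord[OF fi pos, of x z] x z by simp
          finally show ?thesis using True by simp
        qed simp
      qed (rule integrable_indicator_unit[OF ci] integrable_indicator_unit[OF mi], simp)+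
      also have "\<dots> = q" by (simp add: q_def mult.commute)
      finally have "\<kappa> * moment f z \<le> \<kappa> * M" using qM by simp
      then show ?thesis using \<kappa> by simp
    qed
    let ?E = "\<lambda>x. indicator {0<..\<epsilon>} x + indicator {1-\<epsilon><..1} x :: real"
    have iE: "integrable unit_measure (\<lambda>x. indicator {u<..v} x :: real)" for u v
      using integrable_indicator_unit[OF ci[of 1], of "{u<..v}"] by simp
    have "1 = (\<integral>x. f x * moment f x \<partial>unit_measure)" using variance_moment[OF fi] var by simp
    also have "\<dots> \<le> (\<integral>x. 1 / (2 * N0) * ((f x)\<^sup>2 * h x) + N0 / 2 * (2 / c * ?E x + M\<^sup>2 / D) \<partial>unit_measure)"
    proof (rule integral_unit_mono)
      show "integrable unit_measure (\<lambda>x. f x * moment f x)"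
        by (rule integrable_times_continuous[OF fi continuous_moment[OF fi]])
      show "integrable unit_measure (\<lambda>x. 1 / (2 * N0) * ((f x)\<^sup>2 * h x) + N0 / 2 * (2 / c * ?E x + M\<^sup>2 / D))"
        using energy_integrable[OF f continuous_h] iE by simp
      fix x :: real assume x: "0 < x" "x < 1"
      have hx: "h x > 0" using h_pos x by simp
      have low: "c * (x * (1 - x)) \<le> h x" using h_lower_bound[of x] x by (simp add: c_def)
      have m: "(moment f x)\<^sup>2 \<le> (2 / c * ?E x + M\<^sup>2 / D) * h x"
      proof (cases "\<epsilon> < x \<and> x \<le> 1 - \<epsilon>")
        case True
        have "\<epsilon> * (1 - \<epsilon>) \<le> x * (1 - x)"
        proof -
          have "0 \<le> (x - \<epsilon>) * (1 - \<epsilon> - x)" using True by simp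
          then show ?thesis by (simp add: algebra_simps)
        qed
        then have "D \<le> h x" using low c unfolding D_def
          by (meson less_imp_le mult_left_mono order_trans)
        then have "M\<^sup>2 * 1 \<le> M\<^sup>2 * (h x / D)" using D by (intro mult_left_mono) auto
        moreover have "(moment f x)\<^sup>2 \<le> M\<^sup>2" using mM[of x] m0[of x] x by (intro power_mono) auto
        ultimately show ?thesis using True by (simp add: indicator_def)
      next
        case False
        then have E: "1 \<le> ?E x" using x by (auto simp: indicator_def)
        have "(moment f x)\<^sup>2 \<le> 2 * (x * (1 - x))" using moment_bound[OF fi, of x] x var by simp
        also have "\<dots> = 2 / c * (c * (x * (1 - x)))" using c by simp
        also have "\<dots> \<le> 2 / c * h x" using low c by (intro mult_left_mono) auto
        also have "\<dots> \<le> (2 / c * ?E x + M\<^sup>2 / D) * h x"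
        proof (rule mult_right_mono)
          have "2 / c * 1 \<le> 2 / c * ?E x" using E c by (intro mult_left_mono) auto
          moreover have "0 \<le> M\<^sup>2 / D" using D by simp
          ultimately show "2 / c \<le> 2 / c * ?E x + M\<^sup>2 / D" by linarith
        qed (use hx in simp)
        finally show ?thesis .
      qed
      have "0 \<le> (f x * h x - N0 * moment f x)\<^sup>2 / (2 * N0 * h x)" using N0 hx by simp
      also have "\<dots> = 1 / (2 * N0) * ((f x)\<^sup>2 * h x) - f x * moment f x + N0 / 2 * ((moment f x)\<^sup>2 / h x)"
        using N0 hx by (simp add: power2_eq_square field_simps)
      finally have "f x * moment f x \<le> 1 / (2 * N0) * ((f x)\<^sup>2 * h x) + N0 / 2 * ((moment f x)\<^sup>2 / h x)"
        by linarith
      also have "N0 / 2 * ((moment f x)\<^sup>2 / h x) \<le> N0 / 2 * (2 / c * ?E x + M\<^sup>2 / D)"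
        using m N0 hx by (intro mult_left_mono) (auto simp: pos_divide_le_eq)
      finally show "f x * moment f x \<le> 1 / (2 * N0) * ((f x)\<^sup>2 * h x) + N0 / 2 * (2 / c * ?E x + M\<^sup>2 / D)"
        by simp
    qed
    also have "\<dots> = 1 / (2 * N0) * energy h f + N0 / 2 * (2 / c * (\<epsilon> + \<epsilon>) + M\<^sup>2 / D)"
      using energy_integrable[OF f continuous_h] iE ind[of 0 \<epsilon> 1] ind[of "1 - \<epsilon>" 1 1] \<epsilon>
      by (simp add: energy_def)
    also have "\<dots> \<le> 1 / (2 * N0) * N0 + N0 / 2 * (2 / c * (\<epsilon> + \<epsilon>) + M\<^sup>2 / D)"
      using en N0 by (intro add_right_mono mult_left_mono) auto
    also have "\<dots> = 1 / 2 + N0 / 2 * (4 * \<epsilon> / c + 1 / (2 * N0))"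
      using N0 D by (simp add: M(2))
    also have "\<dots> \<le> 1 / 2 + N0 / 2 * (1 / (4 * N0) + 1 / (2 * N0))"
    proof -
      have "4 * \<epsilon> / c \<le> 1 / (4 * N0)" using \<epsilon>(3) c N0 by (simp add: field_simps)
      then show ?thesis using N0 by (intro add_left_mono mult_left_mono add_right_mono) auto
    qed
    also have "\<dots> = 7 / 8" using N0 by (simp add: field_simps)
    finally show False by simp
  qed
  then show ?thesis using \<kappa> M by (intro exI[of _ "\<kappa> * M"]) auto
qed

text \<open>A quantitative substitute for the fact that the derivative of a first eigenfunction vanishes on no
  interval. If \<open>f\<close> is nearly optimal and has little mass on \<open>J = {a<..b}\<close>, consider adding \<open>t\<close> times the
  indicator of \<open>J\<close>. To first order in \<open>t\<close> the variance grows by twice the integral of the moment over \<open>J\<close>,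
  which is bounded from below, whereas the energy grows by twice the integral of \<open>f h\<close> over \<open>J\<close>, which is small.
  For suitable \<open>t\<close> this contradicts the Poincare inequality with constant \<open>\<sigma>\<close>.\<close>
lemma sigma_stability:
  assumes ab: "0 < a" "a < b" "b < 1"
  shows "\<exists>c>0. \<forall>f. square_integrable f \<longrightarrow> (\<forall>x. 0 < x \<longrightarrow> x < 1 \<longrightarrow> 0 \<le> f x) \<longrightarrow>
    variance (\<lambda>x. 1) f = 1 \<longrightarrow>
    c \<le> energy h f - spectral_gap h (\<lambda>x. 1) + (\<integral>x. (f x)\<^sup>2 * indicator {a<..b} x \<partial>unit_measure)"
proof -
  define \<sigma> where "\<sigma> = spectral_gap h (\<lambda>x. 1)"
  have \<sigma>: "\<sigma> > 0" unfolding \<sigma>_def by (rule sigma_pos)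
  obtain q where q: "q > 0" and qm: "\<And>f. square_integrable f \<Longrightarrow> (\<And>x. 0 < x \<Longrightarrow> x < 1 \<Longrightarrow> 0 \<le> f x) \<Longrightarrow>
    variance (\<lambda>x. 1) f = 1 \<Longrightarrow> energy h f \<le> \<sigma> + 1 \<Longrightarrow>
    q \<le> (\<integral>x. indicator {a<..b} x * moment f x \<partial>unit_measure)"
    using moment_integral_lower_bound[OF ab, of "\<sigma> + 1"] \<sigma> by auto
  let ?w = "\<lambda>x. indicator {a<..b} x :: real"
  have w: "square_integrable ?w"
  proof -
    have "?w \<in> borel_measurable unit_measure" by (rule borel_measurable_unitI) simp
    then show ?thesis using square_integrable_times_bounded[OF square_integrable_const[of 1], of ?w 1]
      by (simp add: indicator_def)
  qed
  have wi: "integrable unit_measure ?w" using w by (rule square_integrable_integrable)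
  define C where "C = energy h ?w + 1"
  have "0 \<le> energy h ?w" by (rule energy_nonneg[OF h_nonneg_interior])
  then have C: "C > 0" by (simp add: C_def)
  \<comment> \<open>\<open>s\<close> balances Young's inequality for \<open>2 f \<le> f\<^sup>2 / s + s\<close>, and \<open>t\<close> is the optimal size of the perturbation\<close>
  define s where "s = \<sigma> * q / 4"
  have s: "s > 0" using \<sigma> q by (simp add: s_def)
  define t where "t = \<sigma> * q / (2 * C)"
  have t: "t > 0" using \<sigma> q C by (simp add: t_def)
  define c where "c = min 1 (min (s * s) (\<sigma> * q * t / 4))"
  have c: "c > 0" "c \<le> 1" "c \<le> s * s" "c \<le> \<sigma> * q * t / 4" using s \<sigma> q t by (simp_all add: c_def)
  have "c \<le> energy h f - \<sigma> + (\<integral>x. (f x)\<^sup>2 * ?w x \<partial>unit_measure)"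
    if f: "square_integrable f" and pos: "\<And>x. 0 < x \<Longrightarrow> x < 1 \<Longrightarrow> 0 \<le> f x"
      and var: "variance (\<lambda>x. 1) f = 1" for f
  proof (rule ccontr)
    define Q where "Q = energy h f - \<sigma>"
    define E where "E = (\<integral>x. (f x)\<^sup>2 * ?w x \<partial>unit_measure)"
    assume "\<not> ?thesis"
    then have less: "Q + E < c" by (simp add: Q_def E_def)
    have fi: "integrable unit_measure f" using f by (rule square_integrable_integrable)
    have Q0: "Q \<ge> 0" using spectral_gap_sigma_le[OF f] var by (simp add: Q_def \<sigma>_def)
    have E0: "E \<ge> 0" unfolding E_def by (rule integral_unit_nonneg) simp
    define m where "m = (\<integral>x. ?w x * moment f x \<partial>unit_measure)"
    have m: "q \<le> m" unfolding m_def using qm[OF f pos var] less E0 c(2) by (simp add: Q_def)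
    define I where "I = (\<integral>x. f x * ?w x * h x \<partial>unit_measure)"
    have I: "I \<le> E / s + s"
    proof -
      have "I \<le> (\<integral>x. 1 / s * ((f x)\<^sup>2 * ?w x) + s \<partial>unit_measure)"
        unfolding I_def
      proof (rule integral_unit_mono)
        show "integrable unit_measure (\<lambda>x. f x * ?w x * h x)"
          by (intro integrable_times_continuous square_integrable_prod f w continuous_h)
        show "integrable unit_measure (\<lambda>x. 1 / s * ((f x)\<^sup>2 * ?w x) + s)"
          using integrable_indicator_unit[OF square_integrable_square[OF f], of "{a<..b}"] by simp
        fix x :: real assume x: "0 < x" "x < 1"
        have "f x * h x \<le> f x * 2" using h_le_2[of x] pos[OF x] x by (intro mult_left_mono) auto
        moreover have "0 \<le> (f x - s)\<^sup>2 / s" using s by simp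
        moreover have "(f x - s)\<^sup>2 / s = 1 / s * (f x)\<^sup>2 - f x * 2 + s"
          using s by (simp add: power2_eq_square field_simps)
        ultimately have "f x * h x \<le> 1 / s * (f x)\<^sup>2 + s" by linarith
        then show "f x * ?w x * h x \<le> 1 / s * ((f x)\<^sup>2 * ?w x) + s"
          using s by (cases "x \<in> {a<..b}") (simp_all add: indicator_simps)
      qed
      also have "\<dots> = E / s + s"
        using integrable_indicator_unit[OF square_integrable_square[OF f], of "{a<..b}"]
        by (simp add: E_def)
      finally show ?thesis .
    qed
    have "E / s < s" using less Q0 c(3) s by (simp add: pos_divide_less_eq)
    then have I2: "I \<le> \<sigma> * q / 2" using I unfolding s_def by linarith
    have "\<sigma> * variance (\<lambda>x. 1) (\<lambda>x. f x + t * ?w x) \<le> energy h (\<lambda>x. f x + t * ?w x)"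
      unfolding \<sigma>_def by (intro spectral_gap_sigma_le square_integrable_add square_integrable_cmult f w)
    then have "\<sigma> * (1 + 2 * t * m + t\<^sup>2 * variance (\<lambda>x. 1) ?w) \<le> energy h f + 2 * t * I + t\<^sup>2 * energy h ?w"
      unfolding variance_perturb[OF fi wi] energy_perturb[OF continuous_h f w] var m_def I_def .
    moreover have "0 \<le> \<sigma> * (t\<^sup>2 * variance (\<lambda>x. 1) ?w)"
      using \<sigma> variance_nonneg[OF density_1 wi] by simp
    moreover have "t\<^sup>2 * energy h ?w \<le> t\<^sup>2 * C" by (intro mult_left_mono) (simp_all add: C_def)
    moreover have "t\<^sup>2 * C = \<sigma> * q * t / 2" using C by (simp add: t_def power2_eq_square)
    moreover have "2 * t * I \<le> 2 * t * (\<sigma> * q / 2)" using I2 t by (intro mult_left_mono) auto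
    moreover have "\<sigma> * (2 * t * q) \<le> \<sigma> * (2 * t * m)" using m t \<sigma> by (intro mult_left_mono) auto
    ultimately have "\<sigma> * q * t / 2 \<le> Q" by (simp add: Q_def algebra_simps)
    moreover have "0 < \<sigma> * q * t" using \<sigma> q t by simp
    ultimately show False using less E0 c(4) by linarith
  qed
  then show ?thesis using c(1) unfolding \<sigma>_def by blast
qed

lemma variance_cmult: "variance k (\<lambda>x. c * f x) = c\<^sup>2 * variance k f"
proof -
  have "(\<integral>x. (prim (\<lambda>x. c * f x) x)\<^sup>2 * k x \<partial>unit_measure) = c\<^sup>2 * (\<integral>x. (prim f x)\<^sup>2 * k x \<partial>unit_measure)"
    "(\<integral>x. prim (\<lambda>x. c * f x) x * k x \<partial>unit_measure) = c * (\<integral>x. prim f x * k x \<partial>unit_measure)"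
    by (simp_all add: prim_cmult power_mult_distrib mult.assoc)
  then show ?thesis by (simp add: variance_def power_mult_distrib right_diff_distrib)
qed

lemma energy_cmult: "energy k (\<lambda>x. c * f x) = c\<^sup>2 * energy k f"
  by (simp add: energy_def power_mult_distrib mult.assoc)

text \<open>If the comparison of weights is strict on an interval and the two constants agreed, a nearly
  optimal \<open>f\<close> would have little mass on the image \<open>J\<close> of that interval. But then it is not nearly
  optimal by \<open>sigma_stability\<close>. Quantitatively, the constant \<open>\<sigma>\<close> could be improved by \<open>\<eta>\<close>.\<close>
lemma mu_less_2_sigma:
  assumes "\<And>x. 0 \<le> x \<Longrightarrow> x \<le> 1 \<Longrightarrow> h x \<noteq> 2"
  shows "spectral_gap h h < 2 * spectral_gap h (\<lambda>x. 1)"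
proof (rule ccontr)
  define \<sigma> where "\<sigma> = spectral_gap h (\<lambda>x. 1)"
  assume "\<not> ?thesis"
  then have mu: "2 * \<sigma> \<le> spectral_gap h h" by (simp add: \<sigma>_def)
  obtain a b \<delta> where ab: "0 < a" "a < b" "b < 1" and \<delta>: "0 < \<delta>"
    and strict: "\<And>x. x \<in> {a..b} \<Longrightarrow> \<delta> \<le> 2 * h (H x) - (h x)\<^sup>2"
    using h_square_less[OF assms] by auto
  let ?w = "\<lambda>x. indicator {H a<..H b} x :: real"
  have Hab: "0 < H a" "H a < H b" "H b < 1"
    using ab H_bounds[of a] H_bounds[of b] H_less_iff[of a b] by auto
  obtain c where c: "c > 0" and stab: "\<And>f. square_integrable f \<Longrightarrow> (\<And>x. 0 < x \<Longrightarrow> x < 1 \<Longrightarrow> 0 \<le> f x) \<Longrightarrow>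
      variance (\<lambda>x. 1) f = 1 \<Longrightarrow> c \<le> energy h f - \<sigma> + (\<integral>x. (f x)\<^sup>2 * ?w x \<partial>unit_measure)"
    using sigma_stability[OF Hab] unfolding \<sigma>_def by blast
  define \<eta> where "\<eta> = c / (1 + 2 / \<delta>)"
  have \<eta>: "\<eta> > 0" using c \<delta> unfolding \<eta>_def by (intro divide_pos_pos add_pos_pos) auto
  have normalized: "\<sigma> + \<eta> \<le> energy h f"
    if f: "square_integrable f" and pos: "\<And>x. 0 < x \<Longrightarrow> x < 1 \<Longrightarrow> 0 \<le> f x"
      and var: "variance (\<lambda>x. 1) f = 1" for f
  proof -
    define E where "E = (\<integral>x. (f x)\<^sup>2 * ?w x \<partial>unit_measure)"
    have "\<delta> * E = (\<integral>x. (f (H x))\<^sup>2 * ?w (H x) * h x * \<delta> \<partial>unit_measure)"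
      using H_substitution(2)[of "\<lambda>s. (f s)\<^sup>2 * ?w s"] by (simp add: E_def)
    also have "\<dots> \<le> (\<integral>x. (f (H x))\<^sup>2 * h x * (2 * h (H x) - (h x)\<^sup>2) \<partial>unit_measure)"
    proof (rule integral_unit_mono)
      have "integrable unit_measure (\<lambda>x. (f (H x))\<^sup>2 * ?w (H x) * h x)"
        using integrable_indicator_unit[OF square_integrable_square[OF f], of "{H a<..H b}"]
          H_substitution(1)[of "\<lambda>s. (f s)\<^sup>2 * ?w s"] by simp
      then show "integrable unit_measure (\<lambda>x. (f (H x))\<^sup>2 * ?w (H x) * h x * \<delta>)" by simp
      have "integrable unit_measure (\<lambda>x. (f (H x))\<^sup>2 * h x)"
        using square_integrable_square[OF f] H_substitution(1)[of "\<lambda>s. (f s)\<^sup>2"] by simp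
      then show "integrable unit_measure (\<lambda>x. (f (H x))\<^sup>2 * h x * (2 * h (H x) - (h x)\<^sup>2))"
        by (rule integrable_times_continuous) (intro continuous_intros continuous_h continuous_h_H)
      fix x :: real assume x: "0 < x" "x < 1"
      show "(f (H x))\<^sup>2 * ?w (H x) * h x * \<delta> \<le> (f (H x))\<^sup>2 * h x * (2 * h (H x) - (h x)\<^sup>2)"
      proof (cases "H x \<in> {H a<..H b}")
        case True
        then have "x \<in> {a..b}"
          using H_less_iff[of a x] H_less_iff[of b x] ab x by auto
        then have "(f (H x))\<^sup>2 * h x * \<delta> \<le> (f (H x))\<^sup>2 * h x * (2 * h (H x) - (h x)\<^sup>2)"
          using strict h_nonneg_interior x by (intro mult_left_mono) auto
        then show ?thesis using True by simp
      next
        case False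
        then show ?thesis using h_square_le[of x] h_nonneg_interior[OF x] x by simp
      qed
    qed
    also have "\<dots> = 2 * energy h f - energy h (pullback f)" by (rule energy_pullback_eq[OF f, symmetric])
    also have "\<dots> \<le> 2 * (energy h f - \<sigma>)"
      using mu_le_energy_pullback[OF f] mu var by simp
    finally have "E \<le> 2 / \<delta> * (energy h f - \<sigma>)" using \<delta> by (simp add: pos_le_divide_eq mult.commute)
    moreover have "c \<le> energy h f - \<sigma> + E" unfolding E_def by (rule stab[OF f pos var])
    ultimately have "c \<le> (energy h f - \<sigma>) * (1 + 2 / \<delta>)"
      unfolding distrib_left by (simp add: mult.commute)
    moreover have "1 + 2 / \<delta> > 0" using \<delta> by (simp add: add_pos_pos)
    ultimately have "\<eta> \<le> energy h f - \<sigma>" unfolding \<eta>_def by (simp add: pos_divide_le_eq)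
    then show ?thesis by simp
  qed
  have "\<sigma> + \<eta> \<le> spectral_gap h (\<lambda>x. 1)"
  proof (rule le_spectral_gap[OF density_1])
    fix f assume f: "square_integrable f"
    have fi: "integrable unit_measure f" using f by (rule square_integrable_integrable)
    define V where "V = variance (\<lambda>x. 1) (\<lambda>x. \<bar>f x\<bar>)"
    have le: "variance (\<lambda>x. 1) f \<le> V" unfolding V_def by (rule variance_abs[OF density_1 fi])
    have \<sigma>0: "0 \<le> \<sigma> + \<eta>" using sigma_pos \<eta> by (simp add: \<sigma>_def)
    have "(\<sigma> + \<eta>) * V \<le> energy h f"
    proof (cases "V = 0")
      case True
      then show ?thesis using energy_nonneg[OF h_nonneg_interior] by simp
    next
      case False
      then have V: "V > 0" using variance_nonneg[OF density_1, of "\<lambda>x. \<bar>f x\<bar>"] fi by (simp add: V_def)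
      let ?g = "\<lambda>x. 1 / sqrt V * \<bar>f x\<bar>"
      have "\<sigma> + \<eta> \<le> energy h ?g"
      proof (rule normalized)
        show "square_integrable ?g" by (intro square_integrable_cmult square_integrable_abs f)
        show "variance (\<lambda>x. 1) ?g = 1"
          unfolding variance_cmult V_def[symmetric] using V by (simp add: power_divide)
      qed (use V in simp)
      also have "\<dots> = energy h f / V"
        unfolding energy_cmult using V by (simp add: power_divide energy_def)
      finally show ?thesis using V by (simp add: pos_le_divide_eq)
    qed
    moreover have "(\<sigma> + \<eta>) * variance (\<lambda>x. 1) f \<le> (\<sigma> + \<eta>) * V" using le \<sigma>0 by (rule mult_left_mono)
    ultimately show "(\<sigma> + \<eta>) * variance (\<lambda>x. 1) f \<le> energy h f" by linarith
  qed
  then show False using \<eta> by (simp add: \<sigma>_def)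
qed

section \<open>The lower bound for symmetric weights\<close>

text \<open>The derivative \<open>f\<close> is replaced by the quadratic mean \<open>b\<close> of \<open>f\<close> and its reflection, which has the same
  energy because \<open>h\<close> is symmetric. The primitive \<open>B\<close> of \<open>b\<close> centred at \<open>1/2\<close> is odd, hence of mean zero, and
  \<open>B\<^sup>2\<close> dominates the average of \<open>U\<^sup>2\<close> and its reflection for the primitive \<open>U\<close> of \<open>f\<close> centred at \<open>1/2\<close>
  (Minkowski's inequality). Finally, \<open>B\<^sup>2\<close> increases and \<open>h\<close> decreases with the distance from \<open>1/2\<close>, so
  Chebyshev's inequality says that the weight \<open>h\<close> of unit mass only lowers the integral of \<open>B\<^sup>2\<close>.\<close>
lemma sigma_le_mu:
  assumes sym: "\<And>x. 0 \<le> x \<Longrightarrow> x \<le> 1 \<Longrightarrow> h (1 - x) = h x"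
  shows "spectral_gap h (\<lambda>x. 1) \<le> spectral_gap h h"
proof (rule le_spectral_gap[OF density_h])
  fix f assume f: "square_integrable f"
  have fi: "integrable unit_measure f" using f by (rule square_integrable_integrable)
  define f' where "f' x = f (1 - x)" for x
  define b where "b x = sqrt (((f x)\<^sup>2 + (f' x)\<^sup>2) / 2)" for x
  have f'i: "integrable unit_measure f'" using reflect_unit(1)[of f] fi by (simp add: f'_def[abs_def])
  have f'2: "integrable unit_measure (\<lambda>x. (f' x)\<^sup>2)"
    using reflect_unit(1)[of "\<lambda>x. (f x)\<^sup>2"] square_integrable_square[OF f] by (simp add: f'_def)
  have f': "square_integrable f'" using f'i f'2 by (simp add: square_integrable_def)
  have b2: "(b x)\<^sup>2 = ((f x)\<^sup>2 + (f' x)\<^sup>2) / 2" for x by (simp add: b_def)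
  have b: "square_integrable b"
  proof -
    have "b \<in> borel_measurable unit_measure" unfolding b_def[abs_def]
      using square_integrable_measurable[OF f] square_integrable_measurable[OF f'] by measurable
    then show ?thesis
      unfolding square_integrable_def b2 using square_integrable_square[OF f] f'2 by simp
  qed
  have bi: "integrable unit_measure b" using b by (rule square_integrable_integrable)
  have b0: "0 \<le> b x" for x by (simp add: b_def)
  have bsym: "b (1 - x) = b x" for x by (simp add: b_def f'_def add.commute)
  have prim_reflect: "prim (\<lambda>x. g (1 - x)) x = prim g 1 - prim g (1 - x)"
    if g: "integrable unit_measure g" and x: "0 \<le> x" "x \<le> 1" for g x
  proof -
    have "prim (\<lambda>x. g (1 - x)) x = (\<integral>t. g (1 - t) * indicator {1 - x..} (1 - t) \<partial>unit_measure)"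
      unfolding prim_def by (rule integral_unit_cong) (auto simp: indicator_def)
    also have "\<dots> = (\<integral>t. g t * indicator {1 - x..} t \<partial>unit_measure)"
      by (rule reflect_unit(2))
    also have "\<dots> = (\<integral>t. g t * indicator {1 - x<..1} t \<partial>unit_measure)"
    proof (rule integral_cong_AE)
      show "AE t in unit_measure. g t * indicator {1 - x..} t = g t * indicator {1 - x<..1} t"
        using AE_unit_neq[of "1 - x"] AE_I2[of unit_measure "\<lambda>t. 0 < t \<and> t < 1"]
        by (auto simp: indicator_def elim!: eventually_elim2)
    qed (use integrable_indicator_unit[OF g] in \<open>auto intro!: borel_measurable_integrable\<close>)
    also have "\<dots> = prim g 1 - prim g (1 - x)" using prim_diff[OF g, of "1 - x" 1] x by simp
    finally show ?thesis .
  qed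
  define B where "B x = prim b x - prim b (1/2)" for x
  have Bodd: "B (1 - x) = - B x" if "0 \<le> x" "x \<le> 1" for x
    using prim_reflect[OF bi that] prim_reflect[OF bi, of "1/2"] unfolding bsym by (simp add: B_def)
  have cB: "continuous_on {0..1} B" unfolding B_def by (intro continuous_intros continuous_prim bi)
  have Bmono: "\<bar>B x\<bar> \<le> \<bar>B y\<bar>" if "\<bar>x - 1/2\<bar> \<le> \<bar>y - 1/2\<bar>" "0 \<le> x" "x \<le> 1" "0 \<le> y" "y \<le> 1" for x y
  proof -
    have right: "\<bar>B u\<bar> \<le> \<bar>B v\<bar>" if "1/2 \<le> u" "u \<le> v" for u v
      using prim_mono[OF bi, of "1/2" u] prim_mono[OF bi, of u v] that b0 by (simp add: B_def)
    have fold: "\<bar>B z\<bar> = \<bar>B (1/2 + \<bar>z - 1/2\<bar>)\<bar>" if "0 \<le> z" "z \<le> 1" for z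
      using Bodd[OF that] by (cases "1/2 \<le> z") (auto simp: abs_if)
    show ?thesis unfolding fold[OF that(2,3)] fold[OF that(4,5)] by (rule right) (use that in auto)
  qed
  have hmono: "h y \<le> h x" if "\<bar>x - 1/2\<bar> \<le> \<bar>y - 1/2\<bar>" "0 \<le> x" "x \<le> 1" "0 \<le> y" "y \<le> 1" for x y
  proof -
    have right: "h v \<le> h u" if "1/2 \<le> u" "u \<le> v" "v \<le> 1" for u v
    proof (cases "v = 1/2")
      case False
      have "(v - u) * h (1 - v) + (u - (1 - v)) * h v \<le> (v - (1 - v)) * h u"
        using chord[of "1 - v" u v] that by simp
      then have "(2 * v - 1) * h v \<le> (2 * v - 1) * h u"
        unfolding sym[of v, OF order_trans[OF _ order_trans[OF that(1,2)]] that(3), simplified]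
        by (simp add: algebra_simps)
      then show ?thesis using False that by simp
    next
      case True
      then have "u = v" using that by linarith
      then show ?thesis by simp
    qed
    have fold: "h z = h (1/2 + \<bar>z - 1/2\<bar>)" if "0 \<le> z" "z \<le> 1" for z
      using sym[OF that] by (cases "1/2 \<le> z") (auto simp: abs_if)
    show ?thesis unfolding fold[OF that(2,3)] fold[OF that(4,5)] by (rule right) (use that in auto)
  qed
  have iB: "integrable unit_measure (\<lambda>x. (B x)\<^sup>2)" "integrable unit_measure (\<lambda>x. (B x)\<^sup>2 * h x)"
    by (intro integrable_continuous_unit continuous_intros cB continuous_h)+
  have chebyshev: "(\<integral>x. (B x)\<^sup>2 * h x \<partial>unit_measure) \<le> (\<integral>x. (B x)\<^sup>2 \<partial>unit_measure)"
  proof -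
    \<comment> \<open>\<open>B\<^sup>2 - (B z)\<^sup>2\<close> and \<open>h - 1\<close> have opposite signs everywhere\<close>
    obtain z where z: "0 \<le> z" "z \<le> 1" "h z = 1"
      using mean_value_attained[OF density_1 continuous_h] integral_h by auto
    have "(\<integral>x. (B x)\<^sup>2 * h x \<partial>unit_measure)
        \<le> (\<integral>x. (B x)\<^sup>2 + (B z)\<^sup>2 * h x - (B z)\<^sup>2 \<partial>unit_measure)"
    proof (rule integral_unit_mono)
      fix x :: real assume x: "0 < x" "x < 1"
      have "((B x)\<^sup>2 - (B z)\<^sup>2) * (h x - 1) \<le> 0"
      proof (cases "\<bar>x - 1/2\<bar> \<le> \<bar>z - 1/2\<bar>")
        case True
        then show ?thesis using Bmono[of x z] hmono[of x z] x z
          by (intro mult_nonpos_nonneg) (auto simp: abs_le_square_iff)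
      next
        case False
        then show ?thesis using Bmono[of z x] hmono[of z x] x z
          by (intro mult_nonneg_nonpos) (auto simp: abs_le_square_iff)
      qed
      then show "(B x)\<^sup>2 * h x \<le> (B x)\<^sup>2 + (B z)\<^sup>2 * h x - (B z)\<^sup>2"
        by (simp add: algebra_simps)
    qed (use iB integrable_h in simp_all)
    also have "\<dots> = (\<integral>x. (B x)\<^sup>2 \<partial>unit_measure)" using iB integrable_h integral_h by simp
    finally show ?thesis .
  qed
  define U where "U x = prim f x - prim f (1/2)" for x
  have cU: "continuous_on {0..1} U" unfolding U_def by (intro continuous_intros continuous_prim fi)
  have minkowski: "(U x)\<^sup>2 + (U (1 - x))\<^sup>2 \<le> 2 * (B x)\<^sup>2" if x: "1/2 \<le> x" "x \<le> 1" for x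
  proof -
    \<comment> \<open>\<open>(P, R)\<close> is the integral of \<open>(f, f')\<close> over \<open>{1/2..x}\<close>; its length \<open>r\<close> is found by pairing with \<open>(P, R)\<close>\<close>
    define P where "P = U x"
    define R where "R = - U (1 - x)"
    have RR: "R = prim f' x - prim f' (1/2)"
      using prim_reflect[OF fi, of x] prim_reflect[OF fi, of "1/2"] x
      unfolding f'_def[abs_def, symmetric] by (simp add: R_def U_def)
    define r where "r = sqrt (P\<^sup>2 + R\<^sup>2)"
    have r: "r\<^sup>2 = P\<^sup>2 + R\<^sup>2" "0 \<le> r" by (simp_all add: r_def)
    have i1: "integrable unit_measure (\<lambda>t. P * f t)" "integrable unit_measure (\<lambda>t. R * f' t)"
      "integrable unit_measure (\<lambda>t. r * sqrt 2 * b t)" "integrable unit_measure (\<lambda>t. P * f t + R * f' t)"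
      using fi f'i bi by simp_all
    have "r\<^sup>2 = prim (\<lambda>t. P * f t + R * f' t) x - prim (\<lambda>t. P * f t + R * f' t) (1/2)"
      unfolding prim_add[OF i1(1,2)] prim_cmult r(1)
      unfolding RR by (simp add: P_def U_def power2_eq_square algebra_simps)
    also have "\<dots> \<le> prim (\<lambda>t. r * sqrt 2 * b t) x - prim (\<lambda>t. r * sqrt 2 * b t) (1/2)"
      unfolding prim_diff[OF i1(3) x(1)] prim_diff[OF i1(4) x(1)]
    proof (rule integral_unit_mono)
      fix t :: real
      have "(P * f t + R * f' t)\<^sup>2 \<le> (r * sqrt 2 * b t)\<^sup>2"
      proof -
        have "0 \<le> (P * f' t - R * f t)\<^sup>2" by simp
        then have "(P * f t + R * f' t)\<^sup>2 \<le> (P\<^sup>2 + R\<^sup>2) * ((f t)\<^sup>2 + (f' t)\<^sup>2)"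
          by (simp add: power2_eq_square algebra_simps)
        also have "\<dots> = (r * sqrt 2 * b t)\<^sup>2" by (simp add: power_mult_distrib b2 r)
        finally show ?thesis .
      qed
      then have "P * f t + R * f' t \<le> r * sqrt 2 * b t"
        by (rule power2_le_imp_le) (simp add: r b0)
      then show "(P * f t + R * f' t) * indicator {1/2<..x} t \<le> r * sqrt 2 * b t * indicator {1/2<..x} t"
        by (auto simp: indicator_def)
    qed (rule integrable_indicator_unit[OF i1(3)] integrable_indicator_unit[OF i1(4)], simp)+
    also have "\<dots> = r * (sqrt 2 * B x)" unfolding prim_cmult by (simp add: B_def algebra_simps)
    finally have *: "r\<^sup>2 \<le> r * (sqrt 2 * B x)" .
    have "r \<le> sqrt 2 * \<bar>B x\<bar>"
    proof (cases "r = 0")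
      case False
      then have "r > 0" using r by simp
      then have "r \<le> sqrt 2 * B x" using * by (simp add: power2_eq_square)
      also have "\<dots> \<le> sqrt 2 * \<bar>B x\<bar>" by (intro mult_left_mono) auto
      finally show ?thesis .
    qed simp
    then have "r\<^sup>2 \<le> (sqrt 2 * \<bar>B x\<bar>)\<^sup>2" using r by (intro power_mono) auto
    then show ?thesis unfolding r by (simp add: P_def R_def power_mult_distrib)
  qed
  have minkowski': "(U x)\<^sup>2 + (U (1 - x))\<^sup>2 \<le> 2 * (B x)\<^sup>2" if x: "0 < x" "x < 1" for x
  proof (cases "1/2 \<le> x")
    case True then show ?thesis using minkowski x by simp
  next
    case False
    then show ?thesis using minkowski[of "1 - x"] x Bodd[of x] by simp
  qed
  have iU: "integrable unit_measure (\<lambda>x. (U x)\<^sup>2 * h x)"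
    by (intro integrable_continuous_unit continuous_intros cU continuous_h)
  have U': "(\<integral>x. (U (1 - x))\<^sup>2 * h x \<partial>unit_measure) = (\<integral>x. (U x)\<^sup>2 * h x \<partial>unit_measure)"
    "integrable unit_measure (\<lambda>x. (U (1 - x))\<^sup>2 * h x)"
  proof -
    have eq: "(U (1 - x))\<^sup>2 * h x = (U (1 - x))\<^sup>2 * h (1 - x)" if "0 < x" "x < 1" for x
      using sym[of x] that by simp
    show "(\<integral>x. (U (1 - x))\<^sup>2 * h x \<partial>unit_measure) = (\<integral>x. (U x)\<^sup>2 * h x \<partial>unit_measure)"
      using integral_unit_cong[OF eq] reflect_unit(2)[of "\<lambda>x. (U x)\<^sup>2 * h x"] by simp
    show "integrable unit_measure (\<lambda>x. (U (1 - x))\<^sup>2 * h x)"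
      using integrable_unit_cong[OF eq] reflect_unit(1)[of "\<lambda>x. (U x)\<^sup>2 * h x"] iU by simp
  qed
  have "2 * (\<integral>x. (U x)\<^sup>2 * h x \<partial>unit_measure)
      = (\<integral>x. (U x)\<^sup>2 * h x + (U (1 - x))\<^sup>2 * h x \<partial>unit_measure)"
    using iU U' by simp
  also have "\<dots> \<le> (\<integral>x. 2 * ((B x)\<^sup>2 * h x) \<partial>unit_measure)"
  proof (rule integral_unit_mono)
    fix x :: real assume x: "0 < x" "x < 1"
    show "(U x)\<^sup>2 * h x + (U (1 - x))\<^sup>2 * h x \<le> 2 * ((B x)\<^sup>2 * h x)"
      using mult_right_mono[OF minkowski'[OF x] h_nonneg_interior[OF x]] by (simp add: algebra_simps)
  qed (use iU U' iB in simp_all)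
  finally have UB: "(\<integral>x. (U x)\<^sup>2 * h x \<partial>unit_measure) \<le> (\<integral>x. (B x)\<^sup>2 * h x \<partial>unit_measure)"
    using iB by simp
  have varB: "variance (\<lambda>x. 1) b = (\<integral>x. (B x)\<^sup>2 \<partial>unit_measure)"
  proof -
    have "(\<integral>x. B x \<partial>unit_measure) = (\<integral>x. B (1 - x) \<partial>unit_measure)"
      by (rule reflect_unit(2)[symmetric])
    also have "\<dots> = (\<integral>x. - B x \<partial>unit_measure)" by (rule integral_unit_cong) (simp add: Bodd)
    finally have "(\<integral>x. B x \<partial>unit_measure) = 0" by simp
    moreover have "integrable unit_measure (prim b)"
      by (intro integrable_continuous_unit continuous_prim bi)
    ultimately have "(\<integral>x. prim b x * 1 \<partial>unit_measure) = prim b (1/2)" by (simp add: B_def)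
    then show ?thesis unfolding variance_eq[OF density_1 bi] by (simp add: B_def)
  qed
  have enB: "energy h b = energy h f"
  proof -
    have i: "integrable unit_measure (\<lambda>x. (f x)\<^sup>2 * h x)" "integrable unit_measure (\<lambda>x. (f' x)\<^sup>2 * h x)"
      using energy_integrable f f' continuous_h by auto
    have "(\<integral>x. (f' x)\<^sup>2 * h x \<partial>unit_measure) = (\<integral>x. (f (1 - x))\<^sup>2 * h (1 - x) \<partial>unit_measure)"
      by (rule integral_unit_cong) (simp add: f'_def sym)
    also have "\<dots> = energy h f" unfolding energy_def by (rule reflect_unit(2)[of "\<lambda>x. (f x)\<^sup>2 * h x"])
    finally have "energy h f' = energy h f" by (simp add: energy_def)
    moreover have "energy h b = (\<integral>x. ((f x)\<^sup>2 * h x + (f' x)\<^sup>2 * h x) / 2 \<partial>unit_measure)"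
      unfolding energy_def b2 by (rule integral_unit_cong) (simp add: algebra_simps)
    ultimately show ?thesis using i by (simp add: energy_def)
  qed
  have "variance h f \<le> (\<integral>x. (U x)\<^sup>2 * h x \<partial>unit_measure)"
    unfolding U_def by (rule variance_le[OF density_h fi])
  also have "\<dots> \<le> variance (\<lambda>x. 1) b" using UB chebyshev varB by simp
  finally have "spectral_gap h (\<lambda>x. 1) * variance h f \<le> spectral_gap h (\<lambda>x. 1) * variance (\<lambda>x. 1) b"
    using sigma_pos by (intro mult_left_mono) auto
  also have "\<dots> \<le> energy h b" by (rule spectral_gap_sigma_le[OF b])
  finally show "spectral_gap h (\<lambda>x. 1) * variance h f \<le> energy h f" unfolding enB .
qed

end

section \<open>Comparison of the two eigenvalues\<close>

theorem theorem1p4: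
  fixes h :: "real \<Rightarrow> real"
  assumes "h \<in> weights1"
  shows "mu1 h / sigma1 h \<le> 2 \<and>
         (mu1 h / sigma1 h = 2 \<longleftrightarrow> (\<exists>x\<^sub>0\<in>{0..1}. \<forall>x\<in>{0..1}. h x = triangle_fun x\<^sub>0 x)) \<and>
         ((\<forall>x\<in>{0..1}. h x = h (1 - x)) \<longrightarrow> 1 \<le> mu1 h / sigma1 h)"
proof -
  interpret unit_weight h using assms by unfold_locales
  have pos: "0 < sigma1 h" unfolding sigma1_spectral_gap by (rule sigma_pos)
  have le: "mu1 h \<le> 2 * sigma1 h"
    unfolding mu1_spectral_gap sigma1_spectral_gap by (rule mu_le_2_sigma)
  have eq: "mu1 h = 2 * sigma1 h \<longleftrightarrow> (\<exists>x\<^sub>0\<in>{0..1}. \<forall>x\<in>{0..1}. h x = triangle_fun x\<^sub>0 x)"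
  proof
    assume "mu1 h = 2 * sigma1 h"
    then have "\<not> mu1 h < 2 * sigma1 h" by simp
    then obtain x0 where "0 \<le> x0" "x0 \<le> 1" "h x0 = 2"
      using mu_less_2_sigma unfolding mu1_spectral_gap sigma1_spectral_gap by blast
    then show "\<exists>x\<^sub>0\<in>{0..1}. \<forall>x\<in>{0..1}. h x = triangle_fun x\<^sub>0 x"
      using triangle_of_peak by (intro bexI[of _ x0]) auto
  next
    assume "\<exists>x\<^sub>0\<in>{0..1}. \<forall>x\<in>{0..1}. h x = triangle_fun x\<^sub>0 x"
    then obtain x0 where x0: "0 \<le> x0" "x0 \<le> 1" "\<And>x. 0 \<le> x \<Longrightarrow> x \<le> 1 \<Longrightarrow> h x = triangle_fun x0 x"
      by auto
    then have "2 * sigma1 h \<le> mu1 h"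
      unfolding mu1_spectral_gap sigma1_spectral_gap
      by (intro two_sigma_le_mu triangle_h_square[of x0]) auto
    then show "mu1 h = 2 * sigma1 h" using le by simp
  qed
  have "sigma1 h \<le> mu1 h" if "\<forall>x\<in>{0..1}. h x = h (1 - x)"
    unfolding mu1_spectral_gap sigma1_spectral_gap
  proof (rule sigma_le_mu)
    fix x :: real assume "0 \<le> x" "x \<le> 1"
    then show "h (1 - x) = h x" by (intro that[THEN bspec, symmetric]) simp
  qed
  moreover have "mu1 h / sigma1 h \<le> 2" "mu1 h / sigma1 h = 2 \<longleftrightarrow> mu1 h = 2 * sigma1 h"
    "1 \<le> mu1 h / sigma1 h \<longleftrightarrow> sigma1 h \<le> mu1 h"
    using pos le by (simp_all add: pos_divide_le_eq pos_le_divide_eq nonzero_divide_eq_eq)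
  ultimately show ?thesis unfolding eq[symmetric] by blast
qed

end
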